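(* Let $(X,d,f)$ be a topological dynamical system with the specification property. Let $K\subseteq M_f(X)$ be a non-empty compact connected set and $U\subset X$ a non-empty open set. Then $$\overline{\rm mdim}_M^{UC}(f,G_K,d)=\overline{\rm mdim}_M^{UC}(f,G_K^{\omega,U},d)=\overline{\rm mdim}_M(f,X,d).$$
   Context: A topological dynamical system (TDS) $(X,d,f)$ consists of a compact metric space $(X,d)$ and a homeomorphism $f:X\to X$. $M(X)$ is the set of Borel probability measures on $X$ with the weak$^*$-topology, and $M_f(X)\subset M(X)$ is the set of $f$-invariant ones. Specification property: for any $\epsilon>0$ there is a positive integer $m=m(\epsilon)$ such that for any finite collection of intervals $I_j=[a_j,b_j]\subset\mathbb N$, $j=1,\dots,k$, with $a_{j+1}-b_j\ge m(\epsilon)$ for $j=1,\dots,k-1$, and any points $x_1,\dots,x_k\in X$, there is $x\in X$ with $d(f^{p}x_j,f^{p+a_j}x)<\epsilon$ for all $p=0,\dots,b_j-a_j$ and $j=1,\dots,k$. Saturated sets: $\mathcal E_n(x)=\frac1n\sum_{i=0}^{n-1}\delta_{f^ix}$; $V_f(x)$ is the set of weak$^*$ limit points of $\{\mathcal E_n(x)\}_{n\ge1}$; $G_K=\{x\in X: V_f(x)=K\}$; $\omega_f(x)=\bigcap_{n\ge0}\overline{\bigcup_{k\ge n}\{f^kx\}}$; $G_K^{\omega,U}=G_K\cap U\cap\{x\in X:\omega_f(x)=X\}$. Upper capacity metric mean dimension: $d_n(x,y)=\max_{0\le i\le n-1}d(f^ix,f^iy)$. For non-empty $Z\subset X$, a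 set $E\subset Z$ is $(n,\epsilon)$-separated if $d_n(x,y)>\epsilon$ for all distinct $x,y\in E$; $s_n(Z,\epsilon)$ is the largest cardinality of $(n,\epsilon)$-separated sets of $Z$; $h^{UC}_{top}(f,Z,\epsilon)=\limsup_{n\to\infty}\frac1n\log s_n(Z,\epsilon)$; $\overline{\rm mdim}_M^{UC}(f,Z,d)=\limsup_{\epsilon\to0}h^{UC}_{top}(f,Z,\epsilon)/|\log\epsilon|$; and $\overline{\rm mdim}_M(f,X,d)=\overline{\rm mdim}_M^{UC}(f,X,d)$. *)

theory Defs
  imports "HOL-Probability.Probability"
begin

section \<open>Topological dynamical systems\<close>

text \<open>
  The compact metric space is the whole of a type of class \<open>metric_space\<close>, with metric
  \<^const>\<open>dist\<close>.
\<close>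

definition TDS :: "('a::metric_space \<Rightarrow> 'a) \<Rightarrow> bool" where
  "TDS f \<longleftrightarrow> compact (UNIV :: 'a set) \<and> (\<exists>g. homeomorphism UNIV UNIV f g)"

text \<open>The intervals and points are indexed by \<open>0, \<dots>, k - 1\<close>.\<close>

definition specification_property :: "('a::metric_space \<Rightarrow> 'a) \<Rightarrow> bool" where
  "specification_property f \<longleftrightarrow>
     (\<forall>\<epsilon>>0. \<exists>m>0. \<forall>k>0. \<forall>(a :: nat \<Rightarrow> nat) (b :: nat \<Rightarrow> nat) (x :: nat \<Rightarrow> 'a).
        (\<forall>j<k. a j \<le> b j) \<longrightarrow>
        (\<forall>j. Suc j < k \<longrightarrow> b j + m \<le> a (Suc j)) \<longrightarrow>
        (\<exists>z. \<forall>j<k. \<forall>p\<le>b j - a j. dist ((f ^^ p) (x j)) ((f ^^ (p + a j)) z) < \<epsilon>))"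

definition omega_limit :: "('a::metric_space \<Rightarrow> 'a) \<Rightarrow> 'a \<Rightarrow> 'a set" where
  "omega_limit f x = (\<Inter>n. closure (\<Union>k\<in>{n..}. {(f ^^ k) x}))"


section \<open>Measures and the weak* topology\<close>

definition borel_probs :: "'a::metric_space measure set" where
  "borel_probs = {\<mu>. sets \<mu> = sets borel \<and> prob_space \<mu>}"

definition invariant_probs :: "('a::metric_space \<Rightarrow> 'a) \<Rightarrow> 'a measure set" where
  "invariant_probs f = {\<mu> \<in> borel_probs. distr \<mu> borel f = \<mu>}"

text \<open>
  The coarsest topology on \<^const>\<open>borel_probs\<close> making \<open>\<mu> \<mapsto> \<integral>\<phi> d\<mu>\<close> continuous for each continuous
  \<open>\<phi>\<close>. It is only used on compact spaces, where every continuous \<open>\<phi>\<close> is bounded.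
\<close>

definition weak_star :: "'a::metric_space measure topology" where
  "weak_star = topology_generated_by
     {{\<mu> \<in> borel_probs. (LINT x|\<mu>. \<phi> x) \<in> V} | (\<phi> :: 'a \<Rightarrow> real) V.
        continuous_on UNIV \<phi> \<and> open V}"

lemma topspace_weak_star [simp]: "topspace weak_star = borel_probs"
proof -
  have "borel_probs \<in> {{\<mu> \<in> borel_probs. (LINT x|\<mu>. \<phi> x) \<in> V} | (\<phi> :: 'a \<Rightarrow> real) V.
        continuous_on UNIV \<phi> \<and> open V}"
    by (rule CollectI, rule exI[of _ "\<lambda>_. 0"], rule exI[of _ UNIV]) auto
  then show ?thesis
    unfolding weak_star_def topology_generated_by_topspace by blast
qed

definition empirical :: "('a::metric_space \<Rightarrow> 'a) \<Rightarrow> nat \<Rightarrow> 'a \<Rightarrow> 'a measure" where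
  "empirical f n x = measure_of UNIV (sets borel)
     (\<lambda>A. (1 / of_nat n) * (\<Sum>i<n. emeasure (return borel ((f ^^ i) x)) A))"

lemma sets_empirical [simp]: "sets (empirical f n x) = sets borel"
  and space_empirical [simp]: "space (empirical f n x) = UNIV"
  unfolding empirical_def
  using sets.sigma_sets_eq[of borel] by (auto simp: sets_measure_of space_measure_of)

lemma emeasure_empirical:
  assumes "A \<in> sets borel"
  shows "emeasure (empirical f n x) A
    = (1 / of_nat n) * (\<Sum>i<n. emeasure (return borel ((f ^^ i) x)) A)"
proof (rule emeasure_measure_of[OF empirical_def])
  show "countably_additive (sets (empirical f n x))
     (\<lambda>A. 1 / of_nat n * (\<Sum>i<n. emeasure (return borel ((f ^^ i) x)) A))"
  proof (rule countably_additiveI)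
    fix B :: "nat \<Rightarrow> 'a set"
    assume B: "range B \<subseteq> sets (empirical f n x)" "disjoint_family B"
    have "(\<Sum>j. 1 / of_nat n * (\<Sum>i<n. emeasure (return borel ((f ^^ i) x)) (B j)))
       = 1 / of_nat n * (\<Sum>i<n. \<Sum>j. emeasure (return borel ((f ^^ i) x)) (B j))"
      by (simp add: suminf_sum)
    also have "(\<Sum>i<n. \<Sum>j. emeasure (return borel ((f ^^ i) x)) (B j))
       = (\<Sum>i<n. emeasure (return borel ((f ^^ i) x)) (\<Union> (range B)))"
      using B by (intro sum.cong refl suminf_emeasure) auto
    finally show "(\<Sum>j. 1 / of_nat n * (\<Sum>i<n. emeasure (return borel ((f ^^ i) x)) (B j)))
       = 1 / of_nat n * (\<Sum>i<n. emeasure (return borel ((f ^^ i) x)) (\<Union> (range B)))" .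
  qed
qed (use assms in \<open>auto simp: positive_def\<close>)

lemma empirical_in_borel_probs: "n > 0 \<Longrightarrow> empirical f n x \<in> borel_probs"
  unfolding borel_probs_def
  by (auto intro!: prob_spaceI
      simp: emeasure_empirical ennreal_divide_times ennreal_divide_self of_nat_less_top)

text \<open>
  Limit points of the sequence, i.e. limits of subsequences; this is not the derived set of its
  range. The value at \<open>n = 0\<close> is irrelevant.
\<close>

definition limit_measures :: "('a::metric_space \<Rightarrow> 'a) \<Rightarrow> 'a \<Rightarrow> 'a measure set" where
  "limit_measures f x =
     {\<mu>. \<exists>r. strict_mono r \<and> limitin weak_star (\<lambda>k. empirical f (r k) x) \<mu> sequentially}"

definition saturated_set :: "('a::metric_space \<Rightarrow> 'a) \<Rightarrow> 'a measure set \<Rightarrow> 'a set" where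
  "saturated_set f K = {x. limit_measures f x = K}"

definition transitive_saturated_set ::
    "('a::metric_space \<Rightarrow> 'a) \<Rightarrow> 'a measure set \<Rightarrow> 'a set \<Rightarrow> 'a set" where
  "transitive_saturated_set f K U = saturated_set f K \<inter> U \<inter> {x. omega_limit f x = UNIV}"


section \<open>Upper capacity metric mean dimension\<close>

definition bowen_dist :: "('a::metric_space \<Rightarrow> 'a) \<Rightarrow> nat \<Rightarrow> 'a \<Rightarrow> 'a \<Rightarrow> real" where
  "bowen_dist f n x y = Max ((\<lambda>i. dist ((f ^^ i) x) ((f ^^ i) y)) ` {0..n - 1})"

definition separated_sets ::
    "('a::metric_space \<Rightarrow> 'a) \<Rightarrow> nat \<Rightarrow> real \<Rightarrow> 'a set \<Rightarrow> 'a set set" where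
  "separated_sets f n \<epsilon> Z =
     {E. E \<subseteq> Z \<and> (\<forall>x\<in>E. \<forall>y\<in>E. x \<noteq> y \<longrightarrow> bowen_dist f n x y > \<epsilon>)}"

definition sep_number :: "('a::metric_space \<Rightarrow> 'a) \<Rightarrow> nat \<Rightarrow> real \<Rightarrow> 'a set \<Rightarrow> nat" where
  "sep_number f n \<epsilon> Z = Max (card ` separated_sets f n \<epsilon> Z)"

text \<open>The maximum exists, and all the separated sets are finite, if the space is compact.\<close>

lemma separated_sets_bounded:
  fixes f :: "'a::metric_space \<Rightarrow> 'a"
  assumes "TDS f" "\<epsilon> > 0"
  shows "\<exists>N. \<forall>E\<in>separated_sets f n \<epsilon> Z. finite E \<and> card E \<le> N"
proof -
  have comp: "compact (UNIV :: 'a set)" and cont: "continuous_on UNIV f"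
    using assms(1) by (auto simp: TDS_def homeomorphism_def)
  have cont_it: "continuous_on UNIV (f ^^ i)" for i
    by (induction i) (auto intro: continuous_on_compose2[OF cont] simp: id_def)
  define B where "B x = (\<Inter>i\<in>{0..n - 1}. {y. dist ((f ^^ i) x) ((f ^^ i) y) < \<epsilon> / 2})" for x
  have "open (B x)" for x
    unfolding B_def
    by (intro open_INT ballI open_Collect_less continuous_intros cont_it) auto
  moreover have "UNIV \<subseteq> (\<Union>x\<in>UNIV. B x)"
    using \<open>\<epsilon> > 0\<close> by (auto simp: B_def)
  ultimately obtain C where C: "finite C" "UNIV \<subseteq> (\<Union>x\<in>C. B x)"
    using compactE_image[OF comp, of UNIV B] by metis
  then obtain c where c: "\<And>y. c y \<in> C \<and> y \<in> B (c y)"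
    by (metis UNIV_I UN_E subsetD)
  have close: "bowen_dist f n x y < \<epsilon>" if "c x = c y" for x y
  proof -
    have "dist ((f ^^ i) x) ((f ^^ i) y) < \<epsilon>" if "i \<in> {0..n - 1}" for i
    proof -
      have "dist ((f ^^ i) (c x)) ((f ^^ i) x) < \<epsilon> / 2" "dist ((f ^^ i) (c x)) ((f ^^ i) y) < \<epsilon> / 2"
        using c[of x] c[of y] that \<open>c x = c y\<close> by (auto simp: B_def)
      then show ?thesis
        by (meson dist_triangle_half_r)
    qed
    then show ?thesis by (simp add: bowen_dist_def)
  qed
  have "finite E \<and> card E \<le> card C" if "E \<in> separated_sets f n \<epsilon> Z" for E
  proof -
    have "inj_on c E"
      using that close unfolding separated_sets_def inj_on_def by force
    then show ?thesis
      using c C(1) by (metis card_inj_on_le image_subsetI inj_on_finite)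
  qed
  then show ?thesis by blast
qed

lemma sep_number_attained:
  assumes "TDS f" "\<epsilon> > 0"
  shows "\<exists>E\<in>separated_sets f n \<epsilon> Z. finite E \<and> card E = sep_number f n \<epsilon> Z"
    and "E \<in> separated_sets f n \<epsilon> Z \<Longrightarrow> finite E \<and> card E \<le> sep_number f n \<epsilon> Z"
proof -
  obtain N where N: "\<And>E. E \<in> separated_sets f n \<epsilon> Z \<Longrightarrow> finite E \<and> card E \<le> N"
    using separated_sets_bounded[OF assms, of n Z] by blast
  then have fin: "finite (card ` separated_sets f n \<epsilon> Z)"
    by (intro bounded_nat_set_is_finite[of _ "Suc N"]) (auto simp: less_Suc_eq_le)
  have "{} \<in> separated_sets f n \<epsilon> Z"
    by (simp add: separated_sets_def)
  then have "sep_number f n \<epsilon> Z \<in> card ` separated_sets f n \<epsilon> Z"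
    unfolding sep_number_def by (intro Max_in fin) auto
  then show "\<exists>E\<in>separated_sets f n \<epsilon> Z. finite E \<and> card E = sep_number f n \<epsilon> Z"
    using N by force
  show "E \<in> separated_sets f n \<epsilon> Z \<Longrightarrow> finite E \<and> card E \<le> sep_number f n \<epsilon> Z"
    unfolding sep_number_def using N fin by auto
qed

text \<open>
  With \<open>log 0 = -\<infinity>\<close> the empty set, for which the notions below are not defined in the
  literature, gets the value \<open>-\<infinity>\<close>, while every non-empty set gets a value \<open>\<ge> 0\<close>. So an equation
  between the dimension of a set and that of the whole space includes that the set is non-empty.
\<close>

definition log_nat :: "nat \<Rightarrow> ereal" where
  "log_nat s = (if s = 0 then -\<infinity> else ereal (ln (real s)))"

definition h_UC :: "('a::metric_space \<Rightarrow> 'a) \<Rightarrow> 'a set \<Rightarrow> real \<Rightarrow> ereal" where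
  "h_UC f Z \<epsilon> = limsup (\<lambda>n. ereal (1 / real n) * log_nat (sep_number f n \<epsilon> Z))"

definition mdim_UC :: "('a::metric_space \<Rightarrow> 'a) \<Rightarrow> 'a set \<Rightarrow> ereal" where
  "mdim_UC f Z = Limsup (at_right 0) (\<lambda>\<epsilon>. h_UC f Z \<epsilon> / ereal \<bar>ln \<epsilon>\<bar>)"

abbreviation mdim :: "('a::metric_space \<Rightarrow> 'a) \<Rightarrow> ereal" where
  "mdim f \<equiv> mdim_UC f UNIV"

end

theory Submission
  imports Defs
begin

text \<open>
  The dimension is monotone in the set, so only \<open>mdim f \<le> mdim_UC f Z\<close> for the transitive saturated
  set \<open>Z\<close> needs an argument. It suffices that for each \<open>\<epsilon>\<close> there is a delay \<open>N\<close> such that every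
  orbit segment of every length is \<open>\<epsilon>\<close>-shadowed, from time \<open>N\<close> on, by a point of \<open>Z\<close>: this turns
  \<open>(n, 3\<epsilon>)\<close>-separated sets of the space into \<open>(n + N, \<epsilon>)\<close>-separated subsets of \<open>Z\<close>.

  To build the shadowing point, embed \<open>K\<close> into \<open>\<nat> \<Rightarrow> \<real>\<close> by integrating countably many test functions.
  The image is compact and connected, so it has a sequence with steps tending to \<open>0\<close> which
  accumulates at exactly the points of the image. Given the first \<open>T\<close> iterates of a point,
  specification yields a point that shadows them, then comes close to every point of the space, and
  then follows orbit segments of a fixed length whose averages are close to the next measure of the
  sequence, for so long that they dominate the past. The limit of these points is as required.
  No ergodic theory enters: for invariant \<open>\<alpha>\<close> the \<open>N\<close>-step Birkhoff averages have the same
  \<open>\<alpha>\<close>-integrals as the functions themselves, and starting points of segments whose averages converge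
  to these integrals are found greedily.
\<close>

section \<open>Herding\<close>

lemma sum_lessThan_add:
  fixes u :: "nat \<Rightarrow> 'b::comm_monoid_add"
  shows "(\<Sum>i<a + b. u i) = (\<Sum>i<a. u i) + (\<Sum>i<b. u (a + i))"
  by (induction b) (auto simp: add.assoc)

lemma abs_sum_le_length:
  fixes u :: "nat \<Rightarrow> real"
  assumes "\<And>i. \<bar>u i\<bar> \<le> c"
  shows "\<bar>\<Sum>i<n. u i\<bar> \<le> real n * c"
  using order.trans[OF sum_abs sum_mono, of "{..<n}" u "\<lambda>_. c"] assms by simp

lemma prob_space_exists_le_expectation:
  fixes h :: "'b \<Rightarrow> real"
  assumes "prob_space M" "integrable M h"
  obtains x where "x \<in> space M" "h x \<le> (LINT y|M. h y)"
proof (rule ccontr)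
  interpret prob_space M by fact
  assume "\<not> thesis"
  then have "(LINT y|M. h y) < h x" if "x \<in> space M" for x
    using \<open>x \<in> space M\<close> \<open>\<And>x. x \<in> space M \<Longrightarrow> h x \<le> (LINT y|M. h y) \<Longrightarrow> thesis\<close>
    by (meson not_le)
  then have "(LINT y|M. h y) < (LINT y|M. h y)"
    by (intro expectation_greater) (auto simp: assms)
  then show False by simp
qed

text \<open>
  The point \<open>xs n\<close> is chosen so that the scalar product of its deviation with the accumulated deviation
  is at most its expectation \<open>0\<close>. So the squared deviation grows at most linearly.
\<close>

lemma herding_square_bound:
  fixes g :: "'i \<Rightarrow> 'b \<Rightarrow> real"
  assumes M: "prob_space M" and "finite I"
    and meas: "\<And>j. j \<in> I \<Longrightarrow> g j \<in> borel_measurable M"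
    and bound: "\<And>j x. j \<in> I \<Longrightarrow> x \<in> space M \<Longrightarrow> \<bar>g j x\<bar> \<le> B"
  obtains xs where
    "\<And>n::nat. (\<Sum>j\<in>I. (\<Sum>l<n. g j (xs l) - (LINT y|M. g j y))\<^sup>2) \<le> real n * (real (card I) * (2 * B)\<^sup>2)"
proof -
  interpret prob_space M by fact
  define h where "h j x = g j x - (LINT y|M. g j y)" for j x
  have int: "integrable M (g j)" if "j \<in> I" for j
    using meas[OF that] bound[OF that] by (intro integrable_const_bound[of _ B]) auto
  have h_int: "integrable M (h j)" "(LINT x|M. h j x) = 0" if "j \<in> I" for j
    using int[OF that] by (auto simp: h_def[abs_def] prob_space)
  have h_bound: "\<bar>h j x\<bar> \<le> 2 * B" if "j \<in> I" "x \<in> space M" for j x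
  proof -
    have "\<bar>LINT y|M. g j y\<bar> \<le> (LINT y|M. \<bar>g j y\<bar>)" by (rule integral_abs_bound)
    also have "\<dots> \<le> (LINT y|M. B)"
      using that bound int by (intro integral_mono) auto
    finally have "\<bar>LINT y|M. g j y\<bar> \<le> B" by (simp add: prob_space)
    then show ?thesis using bound[OF that] by (simp add: h_def)
  qed
  have "\<exists>x. x \<in> space M \<and> (\<Sum>j\<in>I. v j * h j x) \<le> 0" for v
  proof -
    have "integrable M (\<lambda>x. \<Sum>j\<in>I. v j * h j x)" using h_int by auto
    moreover have "(LINT x|M. (\<Sum>j\<in>I. v j * h j x)) = 0"
      using h_int by (subst Bochner_Integration.integral_sum) auto
    ultimately show ?thesis using prob_space_exists_le_expectation[OF M] by metis
  qed
  then obtain X where X: "\<And>v. X v \<in> space M" "\<And>v. (\<Sum>j\<in>I. v j * h j (X v)) \<le> 0" by metis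
  \<comment> \<open>\<open>e n\<close> is the vector of deviations accumulated by the first
    \<open>n\<close> points. The choice of the next point depends on the past through it alone, so
    it serves as the state of the recursion.\<close>
  define e where "e = rec_nat (\<lambda>_. 0) (\<lambda>_ v j. v j + h j (X v))"
  define xs where "xs l = X (e l)" for l
  have e_simps: "e 0 = (\<lambda>_. 0)" "e (Suc n) = (\<lambda>j. e n j + h j (xs n))" for n
    by (simp_all add: e_def xs_def)
  have e_sum: "e n j = (\<Sum>l<n. h j (xs l))" for n j
    by (induction n) (simp_all add: e_simps)
  have "(\<Sum>j\<in>I. (e n j)\<^sup>2) \<le> real n * (real (card I) * (2 * B)\<^sup>2)" for n
  proof (induction n)
    case (Suc n)
    have "(\<Sum>j\<in>I. (e (Suc n) j)\<^sup>2)
        = (\<Sum>j\<in>I. (e n j)\<^sup>2) + 2 * (\<Sum>j\<in>I. e n j * h j (xs n)) + (\<Sum>j\<in>I. (h j (xs n))\<^sup>2)"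
      by (simp add: e_simps power2_sum sum.distrib sum_distrib_left mult.assoc)
    also have "(\<Sum>j\<in>I. e n j * h j (xs n)) \<le> 0" using X(2) by (simp add: xs_def)
    also have "(\<Sum>j\<in>I. (h j (xs n))\<^sup>2) \<le> (\<Sum>j\<in>I. (2 * B)\<^sup>2)"
    proof (rule sum_mono)
      fix j assume "j \<in> I"
      then have "\<bar>h j (xs n)\<bar> \<le> \<bar>2 * B\<bar>" using h_bound[of j "xs n"] X(1) by (force simp: xs_def)
      then show "(h j (xs n))\<^sup>2 \<le> (2 * B)\<^sup>2" by (simp only: abs_le_square_iff)
    qed
    finally show ?case using Suc by (simp add: algebra_simps)
  qed (simp add: e_simps)
  then show thesis using that[of xs] by (simp add: e_sum h_def)
qed

text \<open>The squares grow linearly, so each deviation is of order \<open>sqrt n\<close> and stays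
  below a line of any positive slope up to a constant. Explicitly,
  \<open>n * C = (e * n) * (C / e)\<close> is at most the square of
  \<open>e * n + C / e\<close>.\<close>

lemma herding_linear_bound:
  fixes g :: "'i \<Rightarrow> 'b \<Rightarrow> real"
  assumes "prob_space M" "finite I"
    and "\<And>j. j \<in> I \<Longrightarrow> g j \<in> borel_measurable M"
    and "\<And>j x. j \<in> I \<Longrightarrow> x \<in> space M \<Longrightarrow> \<bar>g j x\<bar> \<le> B"
    and "e > 0"
  obtains xs D where "D \<ge> 0"
    "\<And>(n::nat) j. j \<in> I \<Longrightarrow> \<bar>\<Sum>l<n. g j (xs l) - (LINT y|M. g j y)\<bar> \<le> e * real n + D"
proof -
  obtain xs where xs: "\<And>n::nat. (\<Sum>j\<in>I. (\<Sum>l<n. g j (xs l) - (LINT y|M. g j y))\<^sup>2)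
      \<le> real n * (real (card I) * (2 * B)\<^sup>2)"
    using herding_square_bound[OF assms(1,2), of g B] assms(3,4) by blast
  define C where "C = real (card I) * (2 * B)\<^sup>2"
  have "C \<ge> 0" by (simp add: C_def)
  show thesis
  proof (rule that[of "C / e" xs])
    show "C / e \<ge> 0" using \<open>C \<ge> 0\<close> \<open>e > 0\<close> by simp
    fix n :: nat and j assume "j \<in> I"
    let ?s = "\<Sum>l<n. g j (xs l) - (LINT y|M. g j y)"
    have "?s\<^sup>2 \<le> (\<Sum>j\<in>I. (\<Sum>l<n. g j (xs l) - (LINT y|M. g j y))\<^sup>2)"
      using \<open>j \<in> I\<close> \<open>finite I\<close> by (intro member_le_sum) auto
    also have "\<dots> \<le> real n * C" using xs[of n] by (simp add: C_def)
    also have "real n * C = (e * real n) * (C / e)" using \<open>e > 0\<close> by simp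
    also have "\<dots> \<le> (e * real n + C / e)\<^sup>2"
    proof -
      have "a * b \<le> (a + b)\<^sup>2" if "a \<ge> 0" "b \<ge> 0" for a b :: real
        using that by (simp add: power2_sum)
      from this[of "e * real n" "C / e"] show ?thesis using \<open>C \<ge> 0\<close> \<open>e > 0\<close> by simp
    qed
    finally have "\<bar>?s\<bar> \<le> \<bar>e * real n + C / e\<bar>" by (simp only: abs_le_square_iff)
    then show "\<bar>?s\<bar> \<le> e * real n + C / e" using \<open>C \<ge> 0\<close> \<open>e > 0\<close> by simp
  qed
qed

section \<open>Extending orbits by specification\<close>

text \<open>
  In a block of length \<open>P\<close> the first \<open>m\<close> terms are the uncontrolled gap of the specification property.
\<close>

lemma block_sum_bound:
  fixes u h :: "nat \<Rightarrow> real"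
  assumes u: "\<And>i. \<bar>u i\<bar> \<le> 2" and P: "P = N + m" "P > 0"
    and shadow: "\<And>l. l < J \<Longrightarrow> \<bar>(\<Sum>i<N. u (l * P + m + i)) - h l\<bar> \<le> e * real N"
    and h: "\<And>j. \<bar>\<Sum>l<j. h l\<bar> \<le> e * real j + D"
    and gap: "real m \<le> e * real N" and r: "r \<le> J * P" and N: "N > 0" and e: "e \<ge> 0"
  shows "\<bar>\<Sum>i<r. u i\<bar> \<le> 4 * e * real r + D + 2 * real P"
proof -
  define j where "j = r div P"
  define s where "s = r mod P"
  have rjs: "r = j * P + s" and s: "s < P" using P(2) by (auto simp: j_def s_def)
  have "j * P \<le> J * P" using r rjs by linarith
  then have j: "j \<le> J" using P(2) by simp
  \<comment> \<open>A whole block costs at most \<open>3 * e * N\<close>: the gap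
    \<open>2 * m \<le> 2 * e * N\<close>, the shadowed segment \<open>e * N\<close>.\<close>
  have "j' \<le> J \<Longrightarrow> \<bar>(\<Sum>i<j' * P. u i) - (\<Sum>l<j'. h l)\<bar> \<le> real j' * (3 * e * real N)" for j'
  proof (induction j')
    case (Suc j')
    have "(\<Sum>i<Suc j' * P. u i) = (\<Sum>i<j' * P + (m + N). u i)"
      by (simp add: P algebra_simps)
    also have "\<dots> = (\<Sum>i<j' * P. u i) + (\<Sum>i<m. u (j' * P + i)) + (\<Sum>i<N. u (j' * P + m + i))"
      by (simp add: sum_lessThan_add add.assoc)
    finally have eq: "(\<Sum>i<Suc j' * P. u i) = \<dots>" .
    have "\<bar>\<Sum>i<m. u (j' * P + i)\<bar> \<le> real m * 2" by (intro abs_sum_le_length u)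
    then have "\<bar>(\<Sum>i<Suc j' * P. u i) - (\<Sum>l<Suc j'. h l)\<bar>
        \<le> real j' * (3 * e * real N) + real m * 2 + e * real N"
      using Suc shadow[of j'] unfolding eq by simp
    then show ?case using gap by (simp add: algebra_simps)
  qed simp
  from this[OF j] have 1: "\<bar>\<Sum>i<j * P. u i\<bar> \<le> real j * (3 * e * real N) + (e * real j + D)"
    using h[of j] by linarith
  \<comment> \<open>The unfinished block has fewer than \<open>P\<close> terms, each at most 2 in
    absolute value.\<close>
  have "\<bar>\<Sum>i<s. u (j * P + i)\<bar> \<le> real s * 2" by (intro abs_sum_le_length u)
  then have 2: "\<bar>\<Sum>i<r. u i\<bar> \<le> real j * (3 * e * real N) + (e * real j + D) + 2 * real P"
    using 1 s unfolding rjs sum_lessThan_add by simp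
  \<comment> \<open>As \<open>N \<ge> 1\<close>, the term \<open>e * j\<close> of the herding bound
    fits into \<open>e * j * N\<close>; with \<open>j * N \<le> r\<close> the slope becomes
    \<open>4 * e\<close>.\<close>
  have "e * real j * 1 \<le> e * real j * real N" using e N by (intro mult_left_mono) auto
  moreover have "e * (real j * real N) \<le> e * real r"
    using e by (intro mult_left_mono) (auto simp: rjs P algebra_simps)
  ultimately show ?thesis using 2 by (simp add: algebra_simps)
qed

text \<open>The shape in which specification is used: the first \<open>T\<close> iterates of
  \<open>z\<close> are kept, then \<open>J\<close> segments follow in blocks of length
  \<open>N + m\<close>, each opening with the gap. The gap \<open>m\<close> is fixed before
  \<open>T\<close>, \<open>N\<close> and \<open>J\<close>, so ever longer pasts can be extended at
  the same cost.\<close>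

lemma specification_glue:
  fixes f :: "'a::metric_space \<Rightarrow> 'a"
  assumes "specification_property f" "\<epsilon> > 0"
  obtains m :: nat where
    "\<And>z T N J xs. T > 0 \<Longrightarrow> N > 0 \<Longrightarrow>
       \<exists>z'. (\<forall>i<T. dist ((f ^^ i) z) ((f ^^ i) z') < \<epsilon>) \<and>
            (\<forall>j<J. \<forall>i<N. dist ((f ^^ i) (xs j)) ((f ^^ (T + (j * (N + m) + m + i))) z') < \<epsilon>)"
proof -
  from assms(1)[unfolded specification_property_def, rule_format, OF assms(2)]
  obtain m where m: "\<forall>k>0. \<forall>(a :: nat \<Rightarrow> nat) (b :: nat \<Rightarrow> nat) (x :: nat \<Rightarrow> 'a).
        (\<forall>j<k. a j \<le> b j) \<longrightarrow> (\<forall>j. Suc j < k \<longrightarrow> b j + m \<le> a (Suc j)) \<longrightarrow>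
        (\<exists>z. \<forall>j<k. \<forall>p\<le>b j - a j. dist ((f ^^ p) (x j)) ((f ^^ (p + a j)) z) < \<epsilon>)"
    by (elim exE conjE)
  show thesis
  proof (rule that[of m])
    fix z T N J and xs :: "nat \<Rightarrow> 'a" assume "(T::nat) > 0" "(N::nat) > 0"
    \<comment> \<open>Index 0 is the past, index \<open>Suc l\<close> the segment
      \<open>xs l\<close>. Intervals are closed, hence the right ends with \<open>T - 1\<close> and
      \<open>N - 1\<close>.\<close>
    define a where "a j = (case j of 0 \<Rightarrow> 0 | Suc l \<Rightarrow> T + (l * (N + m) + m))" for j
    define b where "b j = (case j of 0 \<Rightarrow> T - 1 | Suc l \<Rightarrow> T + (l * (N + m) + m) + (N - 1))" for j
    define x where "x j = (case j of 0 \<Rightarrow> z | Suc l \<Rightarrow> xs l)" for j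
    have "\<exists>z'. \<forall>j<Suc J. \<forall>p\<le>b j - a j. dist ((f ^^ p) (x j)) ((f ^^ (p + a j)) z') < \<epsilon>"
      using \<open>T > 0\<close> \<open>N > 0\<close>
      by (intro m[rule_format]) (auto simp: a_def b_def split: nat.splits)
    then obtain z' where z': "\<And>j p. j < Suc J \<Longrightarrow> p \<le> b j - a j \<Longrightarrow>
        dist ((f ^^ p) (x j)) ((f ^^ (p + a j)) z') < \<epsilon>" by blast
    show "\<exists>z'. (\<forall>i<T. dist ((f ^^ i) z) ((f ^^ i) z') < \<epsilon>) \<and>
            (\<forall>j<J. \<forall>i<N. dist ((f ^^ i) (xs j)) ((f ^^ (T + (j * (N + m) + m + i))) z') < \<epsilon>)"
    proof (intro exI conjI allI impI)
      show "dist ((f ^^ i) z) ((f ^^ i) z') < \<epsilon>" if "i < T" for i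
        using z'[of 0 i] that by (simp add: a_def b_def x_def)
      show "dist ((f ^^ i) (xs j)) ((f ^^ (T + (j * (N + m) + m + i))) z') < \<epsilon>"
        if "j < J" "i < N" for j i
        using z'[of "Suc j" i] that by (simp add: a_def b_def x_def add.commute add.left_commute)
    qed
  qed
qed

text \<open>The points of a finite \<open>\<epsilon> / 2\<close>-net are glued behind the past as
  segments of length 1. The time \<open>C\<close> this takes depends only on the net and the gap,
  not on \<open>z\<close> or \<open>T\<close>.\<close>

lemma specification_visit:
  fixes f :: "'a::metric_space \<Rightarrow> 'a"
  assumes "compact (UNIV :: 'a set)" "specification_property f" "\<epsilon> > 0"
  obtains C :: nat where
    "\<And>z T. T > 0 \<Longrightarrow> \<exists>z'. (\<forall>i<T. dist ((f ^^ i) z) ((f ^^ i) z') < \<epsilon>) \<and>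
        (\<forall>y. \<exists>i\<in>{T..<T + C}. dist ((f ^^ i) z') y < \<epsilon>)"
proof -
  have "UNIV \<subseteq> (\<Union>y\<in>UNIV. ball (y :: 'a) (\<epsilon> / 2))"
    using assms(3) by auto
  then obtain S :: "'a set" where S: "finite S" "UNIV \<subseteq> (\<Union>y\<in>S. ball y (\<epsilon> / 2))"
    by (rule compactE_image[OF assms(1) open_ball]) blast
  obtain ys :: "nat \<Rightarrow> 'a" and r where ys: "S = ys ` {i. i < r}"
    using finite_imp_nat_seg_image_inj_on[OF S(1)] by metis
  obtain m where m: "\<And>z T N J xs. T > 0 \<Longrightarrow> N > 0 \<Longrightarrow>
       \<exists>z'. (\<forall>i<T. dist ((f ^^ i) z) ((f ^^ i) z') < \<epsilon> / 2) \<and>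
            (\<forall>j<J. \<forall>i<N. dist ((f ^^ i) (xs j)) ((f ^^ (T + (j * (N + m) + m + i))) z') < \<epsilon> / 2)"
    by (rule specification_glue[OF assms(2), of "\<epsilon> / 2"]) (use assms(3) in auto)
  show thesis
  proof (rule that)
    fix z T assume "(T::nat) > 0"
    obtain z' where z': "\<And>i. i < T \<Longrightarrow> dist ((f ^^ i) z) ((f ^^ i) z') < \<epsilon> / 2"
      "\<And>j i. j < r \<Longrightarrow> i < 1 \<Longrightarrow> dist ((f ^^ i) (ys j)) ((f ^^ (T + (j * (1 + m) + m + i))) z') < \<epsilon> / 2"
      using m[of T 1 z r ys] \<open>T > 0\<close> by auto
    show "\<exists>z'. (\<forall>i<T. dist ((f ^^ i) z) ((f ^^ i) z') < \<epsilon>) \<and>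
        (\<forall>y. \<exists>i\<in>{T..<T + (r * (1 + m))}. dist ((f ^^ i) z') y < \<epsilon>)"
    proof (intro exI conjI allI impI)
      show "dist ((f ^^ i) z) ((f ^^ i) z') < \<epsilon>" if "i < T" for i
        using z'(1)[OF that] assms(3) by linarith
      fix y
      obtain j where j: "j < r" "dist (ys j) y < \<epsilon> / 2" using S(2) unfolding ys by force
      have "j * (1 + m) + (1 + m) \<le> r * (1 + m)"
        using mult_le_mono1[of "Suc j" r "1 + m"] j(1) by simp
      moreover have "dist ((f ^^ (T + (j * (1 + m) + m))) z') y < \<epsilon>"
        using z'(2)[of j 0] j by (simp add: dist_triangle_half_r)
      ultimately show "\<exists>i\<in>{T..<T + (r * (1 + m))}. dist ((f ^^ i) z') y < \<epsilon>"
        by (intro bexI[of _ "T + (j * (1 + m) + m)"]) auto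
    qed
  qed
qed

lemma continuous_on_funpow:
  fixes f :: "'a::topological_space \<Rightarrow> 'a"
  assumes "continuous_on UNIV f"
  shows "continuous_on UNIV (f ^^ i)"
  by (induction i) (auto intro: continuous_on_compose2[OF assms] simp: id_def)

lemma invariant_probs_integral_funpow:
  fixes \<phi> :: "'a::metric_space \<Rightarrow> real"
  assumes "continuous_on UNIV f" "\<alpha> \<in> invariant_probs f" "continuous_on UNIV \<phi>"
  shows "(LINT x|\<alpha>. \<phi> ((f ^^ i) x)) = (LINT x|\<alpha>. \<phi> x)"
proof (induction i)
  case (Suc i)
  have sets: "sets \<alpha> = sets borel" and distr: "distr \<alpha> borel f = \<alpha>"
    using assms(2) by (auto simp: invariant_probs_def borel_probs_def)
  have f: "f \<in> measurable \<alpha> borel"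
    using borel_measurable_continuous_onI[OF assms(1)] by (simp add: measurable_cong_sets[OF sets])
  have \<phi>: "(\<lambda>x. \<phi> ((f ^^ i) x)) \<in> borel_measurable borel"
    by (intro borel_measurable_continuous_onI continuous_on_compose2[OF assms(3)]
        continuous_on_funpow assms(1)) auto
  have "(LINT x|\<alpha>. \<phi> ((f ^^ Suc i) x)) = (LINT x|\<alpha>. \<phi> ((f ^^ i) (f x)))"
    by (simp add: funpow_Suc_right del: funpow.simps)
  also have "\<dots> = (LINT x|distr \<alpha> borel f. \<phi> ((f ^^ i) x))"
    using integral_distr[OF f \<phi>] by simp
  finally show ?case using Suc distr by simp
qed simp

text \<open>One stage of the construction. An extension has fixed costs: visiting the whole space,
  an unfinished block, and the herding constant. Once the past is long, these are negligible against
  \<open>e * (T + r)\<close>, so every partial sum is controlled and not only the last one.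
  \<open>T0\<close> does not depend on \<open>z\<close>, which allows stages to be chained.\<close>

lemma specification_step:
  fixes f :: "'a::metric_space \<Rightarrow> 'a" and \<phi> :: "'i \<Rightarrow> 'a \<Rightarrow> real"
  assumes comp: "compact (UNIV :: 'a set)" and cont: "continuous_on UNIV f"
    and spec: "specification_property f"
    and I: "finite I" and \<phi>: "\<And>j. j \<in> I \<Longrightarrow> continuous_on UNIV (\<phi> j)"
    and bd: "\<And>j x. j \<in> I \<Longrightarrow> \<bar>\<phi> j x\<bar> \<le> 1"
    and \<alpha>: "\<alpha> \<in> invariant_probs f" and e: "e > 0"
  obtains T0 :: nat where "T0 > 0"
    "\<And>z T Tmin. T \<ge> T0 \<Longrightarrow> \<exists>z' T'. T' > T \<and> T' \<ge> Tmin \<and>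
       (\<forall>i<T. dist ((f ^^ i) z) ((f ^^ i) z') < e) \<and>
       (\<forall>y. \<exists>i\<in>{T..<T'}. dist ((f ^^ i) z') y < e) \<and>
       (\<forall>j\<in>I. \<forall>r\<le>T' - T.
          \<bar>\<Sum>i<r. \<phi> j ((f ^^ (T + i)) z') - (LINT x|\<alpha>. \<phi> j x)\<bar> \<le> e * real (T + r))"
proof -
  \<comment> \<open>The block estimate has slope \<open>4 * \<eta>\<close>, which must not exceed
    \<open>e / 2\<close>.\<close>
  define \<eta> where "\<eta> = e / 10"
  have \<eta>: "\<eta> > 0" using e by (simp add: \<eta>_def)
  have prob: "prob_space \<alpha>" and sets: "sets \<alpha> = sets borel"
    using \<alpha> by (auto simp: invariant_probs_def borel_probs_def)
  then interpret \<alpha>: prob_space \<alpha> by simp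
  have space: "space \<alpha> = UNIV" using sets_eq_imp_space_eq[OF sets] by simp
  have meas: "(\<lambda>x. \<phi> j ((f ^^ i) x)) \<in> borel_measurable \<alpha>" if "j \<in> I" for i j
    unfolding measurable_cong_sets[OF sets refl]
    by (intro borel_measurable_continuous_onI continuous_on_compose2[OF \<phi>[OF that]]
        continuous_on_funpow cont) auto
  have int: "integrable \<alpha> (\<lambda>x. \<phi> j ((f ^^ i) x))" if "j \<in> I" for i j
    using bd[OF that] meas[OF that] by (intro \<alpha>.integrable_const_bound[of _ 1]) auto
  define a where "a j = (LINT x|\<alpha>. \<phi> j x)" for j
  have a: "\<bar>a j\<bar> \<le> 1" if "j \<in> I" for j
  proof -
    have "\<bar>a j\<bar> \<le> (LINT x|\<alpha>. \<bar>\<phi> j x\<bar>)" unfolding a_def by (rule integral_abs_bound)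
    also have "\<dots> \<le> (LINT x|\<alpha>. 1)"
      using int[OF that, of 0] bd[OF that] by (intro integral_mono) auto
    finally show ?thesis by (simp add: \<alpha>.prob_space)
  qed
  have "\<exists>d>0. \<forall>x y. dist x y < d \<longrightarrow> \<bar>\<phi> j x - \<phi> j y\<bar> < \<eta>" if "j \<in> I" for j
    using compact_uniformly_continuous[OF \<phi>[OF that] comp] \<eta>
    unfolding uniformly_continuous_on_def dist_real_def by (metis UNIV_I abs_minus_commute dist_commute)
  then obtain d where d: "\<And>j. j \<in> I \<Longrightarrow> d j > 0"
    "\<And>j x y. j \<in> I \<Longrightarrow> dist x y < d j \<Longrightarrow> \<bar>\<phi> j x - \<phi> j y\<bar> < \<eta>" by metis
  \<comment> \<open>At most \<open>e / 2\<close>, because the point is moved twice (for the visits,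
    then for the averages), and so small that each test function in \<open>I\<close> varies by less
    than \<open>\<eta>\<close>.\<close>
  define \<delta> where "\<delta> = Min (insert (e / 2) (d ` I))"
  have \<delta>: "\<delta> > 0" "\<delta> \<le> e / 2" "\<And>j. j \<in> I \<Longrightarrow> \<delta> \<le> d j"
    unfolding \<delta>_def using I d(1) e by (simp, intro Min_le, auto)
  obtain m where m: "\<And>z T N J xs. T > 0 \<Longrightarrow> N > 0 \<Longrightarrow>
       \<exists>z'. (\<forall>i<T. dist ((f ^^ i) z) ((f ^^ i) z') < \<delta>) \<and>
            (\<forall>j<J. \<forall>i<N. dist ((f ^^ i) (xs j)) ((f ^^ (T + (j * (N + m) + m + i))) z') < \<delta>)"
    using specification_glue[OF spec \<delta>(1)] by blast
  obtain C where C: "\<And>z T. T > 0 \<Longrightarrow> \<exists>z'. (\<forall>i<T. dist ((f ^^ i) z) ((f ^^ i) z') < e / 2) \<and>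
        (\<forall>y. \<exists>i\<in>{T..<T + C}. dist ((f ^^ i) z') y < e / 2)"
    using specification_visit[OF comp spec, of "e / 2"] e by auto
  \<comment> \<open>Segments so long that the gap is at most the fraction \<open>\<eta>\<close> of
    them.\<close>
  define N where "N = Suc (nat \<lceil>real m / \<eta>\<rceil>)"
  have N: "N > 0" "real m \<le> \<eta> * real N"
  proof -
    have "real m / \<eta> \<le> real N" unfolding N_def by linarith
    then show "real m \<le> \<eta> * real N" using \<eta> by (simp add: field_simps)
  qed (simp add: N_def)
  define P where "P = N + m"
  define g where "g j x = (\<Sum>i<N. \<phi> j ((f ^^ i) x))" for j x
  \<comment> \<open>By invariance the \<open>N\<close>-step sums have mean \<open>N * a j\<close>,
    so herding these sums steers time averages towards \<open>a j\<close>.\<close>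
  have g_int: "(LINT x|\<alpha>. g j x) = real N * a j" if "j \<in> I" for j
    unfolding g_def using int[OF that] invariant_probs_integral_funpow[OF cont \<alpha> \<phi>[OF that]]
    by (simp add: a_def)
  have g_bd: "\<bar>g j x\<bar> \<le> real N" if "j \<in> I" for j x
    using abs_sum_le_length[of "\<lambda>i. \<phi> j ((f ^^ i) x)" 1 N] bd[OF that] by (simp add: g_def)
  have g_meas: "g j \<in> borel_measurable \<alpha>" if "j \<in> I" for j
    unfolding g_def[abs_def] using meas[OF that] by auto
  have "\<exists>xs D. D \<ge> 0 \<and> (\<forall>j\<in>I. \<forall>n::nat.
      \<bar>\<Sum>l<n. g j (xs l) - (LINT y|\<alpha>. g j y)\<bar> \<le> \<eta> * real n + D)"
    by (rule herding_linear_bound[OF prob I, of g "real N" \<eta>]) (rule g_meas g_bd \<eta> | assumption | blast)+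
  then obtain xs D where D: "D \<ge> 0" "\<And>(n::nat) j. j \<in> I \<Longrightarrow>
      \<bar>\<Sum>l<n. g j (xs l) - (LINT y|\<alpha>. g j y)\<bar> \<le> \<eta> * real n + D"
    by blast
  \<comment> \<open>The fixed costs are \<open>D + 2 * P\<close> from the block estimate and
    \<open>2 * C\<close> from the visits. From \<open>T0\<close> on they use at most half of
    \<open>e * T\<close>.\<close>
  define T0 where "T0 = Suc (nat \<lceil>(D + 2 * real P + 2 * real C) * 2 / e\<rceil>)"
  have T0: "D + 2 * real P + 2 * real C \<le> e / 2 * real T0"
  proof -
    have "(D + 2 * real P + 2 * real C) * 2 / e \<le> real T0" unfolding T0_def by linarith
    then show ?thesis using e by (simp add: field_simps)
  qed
  show thesis
  proof (rule that[of T0])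
    show "T0 > 0" by (simp add: T0_def)
    fix z T Tmin assume T: "T0 \<le> (T::nat)"
    \<comment> \<open>Blocks have length at least 1, so \<open>Suc Tmin\<close> of them last longer
      than \<open>Tmin\<close>.\<close>
    define J where "J = Suc Tmin"
    have "T > 0" using T by (simp add: T0_def)
    then obtain z1 where z1: "\<And>i. i < T \<Longrightarrow> dist ((f ^^ i) z) ((f ^^ i) z1) < e / 2"
        "\<And>y. \<exists>i\<in>{T..<T + C}. dist ((f ^^ i) z1) y < e / 2"
      using C by blast
    \<comment> \<open>The orbit of \<open>z1\<close> is kept up to time \<open>T + C\<close>, so its
      visits survive with an error below \<open>\<delta>\<close>.\<close>
    obtain z' where z': "\<And>i. i < T + C \<Longrightarrow> dist ((f ^^ i) z1) ((f ^^ i) z') < \<delta>"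
        "\<And>j i. j < J \<Longrightarrow> i < N \<Longrightarrow> dist ((f ^^ i) (xs j)) ((f ^^ (T + C + (j * P + m + i))) z') < \<delta>"
      using m[of "T + C" N z1 J xs] N \<open>T > 0\<close> unfolding P_def by auto
    have tail: "\<bar>\<Sum>i<s. \<phi> j ((f ^^ (T + C + i)) z') - a j\<bar> \<le> 4 * \<eta> * real s + D + 2 * real P"
      if j: "j \<in> I" and s: "s \<le> J * P" for j s
    proof (rule block_sum_bound[where h = "\<lambda>l. g j (xs l) - real N * a j", OF _ P_def _ _ _ N(2) s N(1)])
      show "\<bar>\<phi> j ((f ^^ (T + C + i)) z') - a j\<bar> \<le> 2" for i
        using bd[OF j, of "(f ^^ (T + C + i)) z'"] a[OF j] by linarith
      show "P > 0" using N by (simp add: P_def)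
      show "\<eta> \<ge> 0" using \<eta> by simp
      show "\<bar>\<Sum>l<n. g j (xs l) - real N * a j\<bar> \<le> \<eta> * real n + D" for n
        using D(2)[OF j, of n] by (simp add: g_int[OF j])
      fix l assume l: "l < J"
      have "(\<Sum>i<N. \<phi> j ((f ^^ (T + C + (l * P + m + i))) z') - a j) - (g j (xs l) - real N * a j)
          = (\<Sum>i<N. \<phi> j ((f ^^ (T + C + (l * P + m + i))) z') - \<phi> j ((f ^^ i) (xs l)))"
        by (simp add: g_def sum_subtractf)
      also have "\<bar>\<dots>\<bar> \<le> (\<Sum>i<N. \<eta>)"
      proof (rule order.trans[OF sum_abs sum_mono])
        fix i assume "i \<in> {..<N}"
        then have "dist ((f ^^ i) (xs l)) ((f ^^ (T + C + (l * P + m + i))) z') < d j"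
          using z'(2)[OF l, of i] \<delta>(3)[OF j] by auto
        from d(2)[OF j this]
        show "\<bar>\<phi> j ((f ^^ (T + C + (l * P + m + i))) z') - \<phi> j ((f ^^ i) (xs l))\<bar> \<le> \<eta>"
          by linarith
      qed
      finally show "\<bar>(\<Sum>i<N. \<phi> j ((f ^^ (T + C + (l * P + m + i))) z') - a j)
          - (g j (xs l) - real N * a j)\<bar> \<le> \<eta> * real N" by (simp add: mult.commute)
    qed
    show "\<exists>z' T'. T' > T \<and> T' \<ge> Tmin \<and>
       (\<forall>i<T. dist ((f ^^ i) z) ((f ^^ i) z') < e) \<and>
       (\<forall>y. \<exists>i\<in>{T..<T'}. dist ((f ^^ i) z') y < e) \<and>
       (\<forall>j\<in>I. \<forall>r\<le>T' - T.
          \<bar>\<Sum>i<r. \<phi> j ((f ^^ (T + i)) z') - (LINT x|\<alpha>. \<phi> j x)\<bar> \<le> e * real (T + r))"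
    proof (intro exI[of _ z'] exI[of _ "T + C + J * P"] conjI allI ballI impI)
      have "J * 1 \<le> J * P" using N by (intro mult_le_mono2) (simp add: P_def)
      then have "Tmin < J * P" by (simp add: J_def)
      then show "T < T + C + J * P" "Tmin \<le> T + C + J * P" by linarith+
      show "dist ((f ^^ i) z) ((f ^^ i) z') < e" if "i < T" for i
        using z1(1)[OF that] z'(1)[of i] \<delta>(2) that dist_triangle[of "(f ^^ i) z" "(f ^^ i) z'" "(f ^^ i) z1"]
        by simp
      show "\<exists>i\<in>{T..<T + C + J * P}. dist ((f ^^ i) z') y < e" for y
      proof -
        obtain i where i: "i \<in> {T..<T + C}" "dist ((f ^^ i) z1) y < e / 2" using z1(2) by blast
        then have "dist ((f ^^ i) z') y < e"
          using z'(1)[of i] \<delta>(2) dist_triangle3[of "(f ^^ i) z'" y "(f ^^ i) z1"] by simp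
        then show ?thesis using i(1) by (intro bexI[of _ i]) auto
      qed
      fix j r assume j: "j \<in> I" and r: "r \<le> T + C + J * P - T"
      let ?u = "\<lambda>i. \<phi> j ((f ^^ (T + i)) z') - a j"
      have u: "\<bar>?u i\<bar> \<le> 2" for i
        using bd[OF j, of "(f ^^ (T + i)) z'"] a[OF j] by linarith
      have eT: "D + 2 * real P + 2 * real C \<le> e / 2 * real T"
        using T0 T e by (meson half_gt_zero less_imp_le mult_left_mono of_nat_mono order.trans)
      have "\<bar>\<Sum>i<r. ?u i\<bar> \<le> e * real (T + r)"
      \<comment> \<open>During the visits only the trivial bound \<open>2 * r\<close> is available,
        and \<open>T0\<close> was chosen to cover it. Beyond them \<open>tail\<close> handles the
        remaining \<open>s\<close> terms.\<close>
      proof (cases "r \<le> C")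
        case True
        have "\<bar>\<Sum>i<r. ?u i\<bar> \<le> real r * 2" by (rule abs_sum_le_length[OF u])
        also have "\<dots> \<le> e / 2 * real T" using True eT D(1) by simp
        also have "\<dots> \<le> e * real (T + r)" using e by (simp add: algebra_simps)
        finally show ?thesis .
      next
        case False
        define s where "s = r - C"
        have rs: "r = C + s" "s \<le> J * P" using False r by (auto simp: s_def)
        have "(\<Sum>i<r. ?u i) = (\<Sum>i<C. ?u i) + (\<Sum>i<s. \<phi> j ((f ^^ (T + C + i)) z') - a j)"
          by (simp add: rs sum_lessThan_add add.assoc)
        moreover have "\<bar>\<Sum>i<C. ?u i\<bar> \<le> real C * 2" by (rule abs_sum_le_length[OF u])
        moreover note tail[OF j rs(2)]
        moreover have "4 * \<eta> * real s \<le> e / 2 * real s"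
          using e by (intro mult_right_mono) (auto simp: \<eta>_def)
        moreover have "e / 2 * real T \<ge> 0" "e / 2 * real s \<ge> 0" "e * real C \<ge> 0" using e by auto
        moreover have "e * real (T + r) = 2 * (e / 2 * real T) + 2 * (e / 2 * real s) + e * real C"
          by (simp add: rs algebra_simps)
        ultimately show ?thesis using eT by linarith
      qed
      then show "\<bar>\<Sum>i<r. \<phi> j ((f ^^ (T + i)) z') - (LINT x|\<alpha>. \<phi> j x)\<bar> \<le> e * real (T + r)"
        by (simp add: a_def)
    qed
  qed
qed

lemma omega_limit_UNIVI:
  fixes f :: "'a::metric_space \<Rightarrow> 'a"
  assumes "\<And>y n e. e > 0 \<Longrightarrow> \<exists>k\<ge>n. dist ((f ^^ k) z) y < e"
  shows "omega_limit f z = UNIV"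
proof -
  have "y \<in> closure (\<Union>k\<in>{n..}. {(f ^^ k) z})" for y n
    unfolding closure_approachable using assms[of _ n y] by fastforce
  then show ?thesis unfolding omega_limit_def by blast
qed

text \<open>Stage \<open>k\<close> aims at \<open>\<alpha> k\<close> and handles the test functions
  with index below \<open>k\<close>. The errors form a geometric series with sum
  \<open>\<delta>\<close>, so a limit point of the stages shadows all of them. The growth
  \<open>T (Suc k) \<ge> k * T k\<close> lets each stage dominate its past, so at its end the
  average is close to \<open>\<alpha> k\<close>. Since the drift tends to 0, this is also close to
  the target of the next stage, and no time in between is bad.\<close>

lemma specification_tower:
  fixes f :: "'a::metric_space \<Rightarrow> 'a" and \<phi> :: "nat \<Rightarrow> 'a \<Rightarrow> real"
    and \<alpha> :: "nat \<Rightarrow> 'a measure"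
  assumes comp: "compact (UNIV :: 'a set)" and cont: "continuous_on UNIV f"
    and spec: "specification_property f"
    and \<phi>: "\<And>j. continuous_on UNIV (\<phi> j)" and bd: "\<And>j x. \<bar>\<phi> j x\<bar> \<le> 1"
    and \<alpha>: "\<And>k. \<alpha> k \<in> invariant_probs f"
    and drift: "\<And>j. (\<lambda>k. (LINT x|\<alpha> (Suc k). \<phi> j x) - (LINT x|\<alpha> k. \<phi> j x)) \<longlonglongrightarrow> 0"
    and \<delta>: "\<delta> > 0"
  obtains z T where "strict_mono T" "omega_limit f z = UNIV"
    "\<And>i. i < L \<Longrightarrow> dist ((f ^^ i) w) ((f ^^ i) z) \<le> \<delta>"
    "\<And>j e. e > 0 \<Longrightarrow> \<exists>k0. \<forall>k\<ge>k0. \<forall>n\<in>{T k..T (Suc k)}.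
       \<bar>\<Sum>i<n. \<phi> j ((f ^^ i) z) - (LINT x|\<alpha> k. \<phi> j x)\<bar> \<le> e * real n"
proof -
  define a where "a k j = (LINT x|\<alpha> k. \<phi> j x)" for k j
  have a: "\<bar>a k j\<bar> \<le> 1" for k j
  proof -
    interpret prob_space "\<alpha> k" using \<alpha>[of k] by (simp add: invariant_probs_def borel_probs_def)
    have sets: "sets (\<alpha> k) = sets borel" using \<alpha>[of k] by (simp add: invariant_probs_def borel_probs_def)
    have "\<phi> j \<in> borel_measurable (\<alpha> k)"
      unfolding measurable_cong_sets[OF sets refl] by (intro borel_measurable_continuous_onI \<phi>)
    then have int: "integrable (\<alpha> k) (\<phi> j)"
      using bd by (intro integrable_const_bound[of _ 1]) auto
    have "\<bar>a k j\<bar> \<le> (LINT x|\<alpha> k. \<bar>\<phi> j x\<bar>)" unfolding a_def by (rule integral_abs_bound)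
    also have "\<dots> \<le> (LINT x|\<alpha> k. 1)"
      using int bd by (intro integral_mono) auto
    finally show ?thesis by (simp add: prob_space)
  qed
  define ek where "ek k = \<delta> / 2 ^ Suc k" for k :: nat
  have ek: "ek k > 0" for k using \<delta> by (simp add: ek_def)
  define stage where "stage k z T z' T' \<longleftrightarrow> T' > T \<and>
       (\<forall>i<T. dist ((f ^^ i) z) ((f ^^ i) z') < ek k) \<and>
       (\<forall>y. \<exists>i\<in>{T..<T'}. dist ((f ^^ i) z') y < ek k) \<and>
       (\<forall>j<k. \<forall>r\<le>T' - T. \<bar>\<Sum>i<r. \<phi> j ((f ^^ (T + i)) z') - a k j\<bar> \<le> ek k * real (T + r))"
    for k and z z' :: 'a and T T' :: nat
  have "\<exists>T0>0. \<forall>z T Tmin. T \<ge> T0 \<longrightarrow> (\<exists>z' T'. T' \<ge> Tmin \<and> stage k z T z' T')" for k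
  proof -
    have "\<exists>T0>0. \<forall>z T Tmin. T \<ge> T0 \<longrightarrow> (\<exists>z' T'. T' > T \<and> T' \<ge> Tmin \<and>
       (\<forall>i<T. dist ((f ^^ i) z) ((f ^^ i) z') < ek k) \<and>
       (\<forall>y. \<exists>i\<in>{T..<T'}. dist ((f ^^ i) z') y < ek k) \<and>
       (\<forall>j\<in>{..<k}. \<forall>r\<le>T' - T.
          \<bar>\<Sum>i<r. \<phi> j ((f ^^ (T + i)) z') - (LINT x|\<alpha> k. \<phi> j x)\<bar> \<le> ek k * real (T + r)))"
      by (rule specification_step[OF comp cont spec finite_lessThan[of k] _ _ \<alpha>[of k] ek[of k], of \<phi>])
        (rule \<phi> bd | blast)+
    then obtain T0 :: nat where "T0 > 0" and T0: "\<And>z T Tmin. T \<ge> T0 \<Longrightarrow> \<exists>z' T'. T' > T \<and> T' \<ge> Tmin \<and>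
       (\<forall>i<T. dist ((f ^^ i) z) ((f ^^ i) z') < ek k) \<and>
       (\<forall>y. \<exists>i\<in>{T..<T'}. dist ((f ^^ i) z') y < ek k) \<and>
       (\<forall>j\<in>{..<k}. \<forall>r\<le>T' - T.
          \<bar>\<Sum>i<r. \<phi> j ((f ^^ (T + i)) z') - (LINT x|\<alpha> k. \<phi> j x)\<bar> \<le> ek k * real (T + r))"
      by blast
    have "\<exists>z' T'. T' \<ge> Tmin \<and> stage k z T z' T'" if "T \<ge> T0" for z T Tmin
      using T0[OF that, of Tmin z] unfolding stage_def a_def lessThan_iff Ball_def by blast
    then show ?thesis using \<open>T0 > 0\<close> by blast
  qed
  then obtain T0 where T0: "\<And>k. T0 k > (0::nat)"
    "\<And>k z T Tmin. T \<ge> T0 k \<Longrightarrow> \<exists>z' T'. T' \<ge> Tmin \<and> stage k z T z' T'"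
    by metis
  \<comment> \<open>The invariant \<open>T0 k \<le> snd (s k)\<close> makes the next stage possible.
    The prescribed start enters the invariant as its case \<open>k = 0\<close>.\<close>
  have "\<exists>s. \<forall>k. (snd (s k) \<ge> T0 k \<and> (k = 0 \<longrightarrow> fst (s k) = w \<and> snd (s k) \<ge> L)) \<and>
      (snd (s (Suc k)) \<ge> k * snd (s k) \<and> stage k (fst (s k)) (snd (s k)) (fst (s (Suc k))) (snd (s (Suc k))))"
  proof (rule dependent_nat_choice)
    show "\<exists>x. snd x \<ge> T0 0 \<and> ((0::nat) = 0 \<longrightarrow> fst x = w \<and> snd x \<ge> L)"
      by (rule exI[of _ "(w, max (T0 0) L)"]) simp
    fix x :: "'a \<times> nat" and k
    assume x: "snd x \<ge> T0 k \<and> (k = 0 \<longrightarrow> fst x = w \<and> snd x \<ge> L)"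
    obtain z' T' where "T' \<ge> max (T0 (Suc k)) (k * snd x)" "stage k (fst x) (snd x) z' T'"
      using T0(2)[of k "snd x" "max (T0 (Suc k)) (k * snd x)" "fst x"] x by blast
    then show "\<exists>y. (T0 (Suc k) \<le> snd y \<and> (Suc k = 0 \<longrightarrow> fst y = w \<and> L \<le> snd y)) \<and>
        k * snd x \<le> snd y \<and> stage k (fst x) (snd x) (fst y) (snd y)"
      by (intro exI[of _ "(z', T')"]) simp
  qed
  then obtain s where s: "\<And>k. snd (s k) \<ge> T0 k" "fst (s 0) = w" "snd (s 0) \<ge> L"
    "\<And>k. snd (s (Suc k)) \<ge> k * snd (s k)"
    "\<And>k. stage k (fst (s k)) (snd (s k)) (fst (s (Suc k))) (snd (s (Suc k)))"
    by blast
  define zs where "zs k = fst (s k)" for k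
  define T where "T k = snd (s k)" for k
  have st: "stage k (zs k) (T k) (zs (Suc k)) (T (Suc k))" for k
    using s(5) by (simp add: zs_def T_def)
  have T_mono: "strict_mono T" using st by (auto simp: strict_mono_Suc_iff stage_def)
  have T_growth: "k * T k \<le> T (Suc k)" for k using s(4) by (simp add: T_def)
  \<comment> \<open>The bound is written as a difference so that adding \<open>ek (k + p)\<close>
    telescopes.\<close>
  have close: "i < T k \<Longrightarrow> dist ((f ^^ i) (zs k)) ((f ^^ i) (zs (k + p))) \<le> \<delta> / 2 ^ k - \<delta> / 2 ^ (k + p)"
    for i k p
  proof (induction p)
    case (Suc p)
    have "i < T (k + p)" using Suc.prems T_mono by (meson le_add1 less_le_trans strict_mono_less_eq)
    then have "dist ((f ^^ i) (zs (k + p))) ((f ^^ i) (zs (k + Suc p))) < ek (k + p)"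
      using st[of "k + p"] by (simp add: stage_def)
    moreover have "ek (k + p) = \<delta> / 2 ^ (k + p) - \<delta> / 2 ^ (k + Suc p)"
      by (simp add: ek_def field_simps)
    ultimately show ?case
      using Suc.IH[OF Suc.prems] dist_triangle[of "(f ^^ i) (zs k)" "(f ^^ i) (zs (k + Suc p))" "(f ^^ i) (zs (k + p))"]
      by linarith
  qed simp
  \<comment> \<open>A limit along a subsequence suffices, as \<open>close\<close> bounds the
    distance to all later stages.\<close>
  obtain z r where r: "strict_mono r" "(zs \<circ> r) \<longlonglongrightarrow> z"
    using comp[unfolded compact_eq_seq_compact_metric seq_compact_def] by blast
  have lim: "dist ((f ^^ i) (zs k)) ((f ^^ i) z) \<le> \<delta> / 2 ^ k" if "i < T k" for i k
  proof (rule tendsto_upperbound)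
    have "(\<lambda>l. (f ^^ i) ((zs \<circ> r) l)) \<longlonglongrightarrow> (f ^^ i) z"
      using continuous_on_tendsto_compose[OF continuous_on_funpow[OF cont] r(2)] by simp
    then show "(\<lambda>l. dist ((f ^^ i) (zs k)) ((f ^^ i) ((zs \<circ> r) l))) \<longlonglongrightarrow> dist ((f ^^ i) (zs k)) ((f ^^ i) z)"
      by (intro tendsto_intros)
    have "dist ((f ^^ i) (zs k)) ((f ^^ i) ((zs \<circ> r) l)) \<le> \<delta> / 2 ^ k" if "l \<ge> k" for l
    proof -
      have "k \<le> r l" using that seq_suble[OF r(1), of l] by simp
      then obtain p where "r l = k + p" using le_Suc_ex by blast
      moreover have "\<delta> / 2 ^ (k + p) \<ge> 0" using \<delta> by simp
      ultimately show ?thesis using close[OF \<open>i < T k\<close>, of p] by (simp del: zero_le_divide_iff)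
    qed
    then show "\<forall>\<^sub>F l in sequentially. dist ((f ^^ i) (zs k)) ((f ^^ i) ((zs \<circ> r) l)) \<le> \<delta> / 2 ^ k"
      by (auto simp: eventually_sequentially)
  qed simp
  have small: "\<exists>k0. \<forall>k\<ge>k0. \<delta> / 2 ^ k < e" if "e > 0" for e :: real
  proof -
    have "(\<lambda>k. \<delta> * (1 / 2) ^ k) \<longlonglongrightarrow> \<delta> * 0" by (intro tendsto_intros LIMSEQ_realpow_zero) auto
    then show ?thesis using that
      by (auto simp: power_divide eventually_sequentially dest!: order_tendstoD(2))
  qed
  show thesis
  proof (rule that[of T z])
    show "strict_mono T" by fact
    show "dist ((f ^^ i) w) ((f ^^ i) z) \<le> \<delta>" if "i < L" for i
      using lim[of i 0] that s(2,3) by (simp add: T_def zs_def)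
    show "omega_limit f z = UNIV"
    proof (rule omega_limit_UNIVI)
      fix y :: 'a and n :: nat and e :: real assume "e > 0"
      obtain k0 where k0: "\<And>k. k \<ge> k0 \<Longrightarrow> \<delta> / 2 ^ k < e" using small[OF \<open>e > 0\<close>] by blast
      define k where "k = max k0 n"
      \<comment> \<open>The visit happens before \<open>T (Suc k)\<close>, while \<open>z\<close>
        still follows \<open>zs (Suc k)\<close>. Both errors are at most
        \<open>\<delta> / 2 ^ Suc k\<close>.\<close>
      obtain i where i: "i \<in> {T k..<T (Suc k)}" "dist ((f ^^ i) (zs (Suc k))) y < ek k"
        using st[of k] unfolding stage_def by blast
      have "dist ((f ^^ i) z) y \<le> dist ((f ^^ i) (zs (Suc k))) ((f ^^ i) z) + dist ((f ^^ i) (zs (Suc k))) y"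
        by (rule dist_triangle3)
      also have "\<dots> < \<delta> / 2 ^ Suc k + ek k"
        using lim[of i "Suc k"] i by (intro add_le_less_mono) auto
      also have "\<dots> = \<delta> / 2 ^ k" by (simp add: ek_def)
      also have "\<dots> < e" using k0[of k] by (simp add: k_def)
      finally have "dist ((f ^^ i) z) y < e" .
      moreover have "n \<le> i" using seq_suble[OF T_mono, of k] i(1) by (simp add: k_def)
      ultimately show "\<exists>k\<ge>n. dist ((f ^^ k) z) y < e" by blast
    qed
    fix j and e' :: real assume "e' > 0"
    \<comment> \<open>Four shares: two for the end of the previous stage, one for the change of
      target, one for the current stage.\<close>
    define e where "e = e' / 4"
    have "e > 0" using \<open>e' > 0\<close> by (simp add: e_def)
    let ?u = "\<lambda>k i. \<phi> j ((f ^^ i) z) - a k j"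
    have u: "\<bar>?u k i\<bar> \<le> 2" for k i using bd[of j "(f ^^ i) z"] a[of k j] by linarith
    obtain d where d: "d > 0" "\<And>x y. dist x y < d \<Longrightarrow> \<bar>\<phi> j x - \<phi> j y\<bar> < e / 2"
      using compact_uniformly_continuous[OF \<phi>[of j] comp] \<open>e > 0\<close>
      unfolding uniformly_continuous_on_def dist_real_def by (metis UNIV_I half_gt_zero)
    obtain k1 where k1: "\<And>k. k \<ge> k1 \<Longrightarrow> \<delta> / 2 ^ k < min d (e / 2)"
      using small[of "min d (e / 2)"] d(1) \<open>e > 0\<close> by auto
    obtain k2 where k2: "\<And>k. k \<ge> k2 \<Longrightarrow> \<bar>a (Suc k) j - a k j\<bar> < e"
      using LIMSEQ_D[OF drift[of j] \<open>e > 0\<close>] by (auto simp: a_def)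
    \<comment> \<open>From \<open>k0\<close> on, the function with index \<open>j\<close> is
      handled, shadowing error and drift are small, and \<open>2 / e \<le> k\<close> gives
      \<open>2 * T k \<le> e * T (Suc k)\<close>.\<close>
    define k0 where "k0 = Suc (max (max j k1) (max k2 (nat \<lceil>2 / e\<rceil>)))"
    have k0: "k \<ge> k0 \<Longrightarrow> k > j" "k \<ge> k0 \<Longrightarrow> k \<ge> k1" "k \<ge> k0 \<Longrightarrow> k \<ge> k2" "k \<ge> k0 \<Longrightarrow> 2 / e \<le> real k" for k
      unfolding k0_def by linarith+
    have block: "\<bar>\<Sum>i<r. ?u k (T k + i)\<bar> \<le> e * real (T k + r)"
      if "k \<ge> k0" "r \<le> T (Suc k) - T k" for k r
    proof -
      have "(\<Sum>i<r. ?u k (T k + i)) = (\<Sum>i<r. \<phi> j ((f ^^ (T k + i)) (zs (Suc k))) - a k j)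
          + (\<Sum>i<r. \<phi> j ((f ^^ (T k + i)) z) - \<phi> j ((f ^^ (T k + i)) (zs (Suc k))))"
        by (simp add: sum.distrib[symmetric])
      moreover have "\<bar>\<Sum>i<r. \<phi> j ((f ^^ (T k + i)) z) - \<phi> j ((f ^^ (T k + i)) (zs (Suc k)))\<bar> \<le> (\<Sum>i<r. e / 2)"
      proof (rule order.trans[OF sum_abs sum_mono])
        fix i assume "i \<in> {..<r}"
        then have "T k + i < T (Suc k)" using that(2) by simp
        then have "dist ((f ^^ (T k + i)) (zs (Suc k))) ((f ^^ (T k + i)) z) < d"
          using lim[of "T k + i" "Suc k"] k1[of "Suc k"] k0(2)[OF that(1)] by simp
        then show "\<bar>\<phi> j ((f ^^ (T k + i)) z) - \<phi> j ((f ^^ (T k + i)) (zs (Suc k)))\<bar> \<le> e / 2"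
          using d(2) by (metis dist_commute less_imp_le)
      qed
      moreover have "\<bar>\<Sum>i<r. \<phi> j ((f ^^ (T k + i)) (zs (Suc k))) - a k j\<bar> \<le> ek k * real (T k + r)"
        using st[of k] k0(1)[OF that(1)] that(2) by (simp add: stage_def)
      moreover have "ek k * real (T k + r) \<le> e / 2 * real (T k + r)"
      proof (rule mult_right_mono)
        have "ek k \<le> \<delta> / 2 ^ k" using \<delta> by (simp add: ek_def field_simps)
        also have "\<dots> \<le> e / 2" using k1[OF k0(2)[OF that(1)]] by (auto simp only: min_less_iff_conj)
        finally show "ek k \<le> e / 2" .
      qed simp
      moreover have "(\<Sum>i<r. e / 2) \<le> e / 2 * real (T k + r)" using \<open>e > 0\<close> by simp
      ultimately show ?thesis by linarith
    qed
    \<comment> \<open>One \<open>e\<close> pays for the trivial bound \<open>2 * T k\<close> on the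
      past, the other for the stage itself.\<close>
    have endpoint: "\<bar>\<Sum>i<T (Suc k). ?u k i\<bar> \<le> 2 * e * real (T (Suc k))" if "k \<ge> k0" for k
    proof -
      have T: "T (Suc k) = T k + (T (Suc k) - T k)"
        using T_mono by (simp add: strict_mono_less_eq)
      have "(\<Sum>i<T (Suc k). ?u k i) = (\<Sum>i<T k. ?u k i) + (\<Sum>i<T (Suc k) - T k. ?u k (T k + i))"
        by (subst T, subst sum_lessThan_add) simp
      moreover have "\<bar>\<Sum>i<T k. ?u k i\<bar> \<le> real (T k) * 2" by (rule abs_sum_le_length[OF u])
      moreover have "\<bar>\<Sum>i<T (Suc k) - T k. ?u k (T k + i)\<bar> \<le> e * real (T (Suc k))"
        using block[OF that, of "T (Suc k) - T k"] T by simp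
      moreover have "real (T k) * 2 \<le> e * real (T (Suc k))"
      proof -
        have "2 * real (T k) \<le> (e * real k) * real (T k)"
          using k0(4)[OF that] \<open>e > 0\<close> by (intro mult_right_mono) (auto simp: field_simps)
        also have "\<dots> = e * real (k * T k)" by simp
        also have "\<dots> \<le> e * real (T (Suc k))"
          using T_growth[of k] \<open>e > 0\<close> by (intro mult_left_mono) (auto simp del: of_nat_mult)
        finally show ?thesis by simp
      qed
      ultimately show ?thesis by linarith
    qed
    show "\<exists>k0. \<forall>k\<ge>k0. \<forall>n\<in>{T k..T (Suc k)}.
       \<bar>\<Sum>i<n. \<phi> j ((f ^^ i) z) - (LINT x|\<alpha> k. \<phi> j x)\<bar> \<le> e' * real n"
    proof (intro exI allI ballI impI)
      \<comment> \<open>The witness is \<open>Suc k0\<close> because the previous stage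
        \<open>l\<close> must also be at least \<open>k0\<close>.\<close>
      fix k n assume "k \<ge> Suc k0" and n: "n \<in> {T k..T (Suc k)}"
      then obtain l where l: "k = Suc l" "l \<ge> k0" by (metis Suc_le_D Suc_le_mono)
      define r where "r = n - T k"
      have nr: "n = T k + r" "r \<le> T (Suc k) - T k" using n by (auto simp: r_def)
      \<comment> \<open>Up to time \<open>T k\<close> the sum is compared with the previous target
        \<open>a l\<close>; passing to \<open>a k\<close> costs \<open>T k\<close> times the
        drift.\<close>
      have "(\<Sum>i<n. ?u k i) = (\<Sum>i<T k. ?u l i) - real (T k) * (a k j - a l j) + (\<Sum>i<r. ?u k (T k + i))"
        unfolding nr(1) sum_lessThan_add by (simp add: sum_subtractf right_diff_distrib)
      moreover have "\<bar>\<Sum>i<T k. ?u l i\<bar> \<le> 2 * e * real (T k)" using endpoint[OF l(2)] l(1) by simp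
      moreover have "\<bar>real (T k) * (a k j - a l j)\<bar> \<le> e * real (T k)"
        using mult_left_mono[OF less_imp_le[OF k2[OF k0(3)[OF l(2)]]], of "real (T k)"] l(1)
        by (simp add: abs_mult mult.commute)
      moreover have "\<bar>\<Sum>i<r. ?u k (T k + i)\<bar> \<le> e * real n"
        using block[of k r] nr l by simp
      moreover have "e * real (T k) \<le> e * real n" using nr \<open>e > 0\<close> by (intro mult_left_mono) auto
      moreover have "e' * real n = 4 * (e * real n)" by (simp add: e_def)
      ultimately show "\<bar>\<Sum>i<n. \<phi> j ((f ^^ i) z) - (LINT x|\<alpha> k. \<phi> j x)\<bar> \<le> e' * real n"
        unfolding a_def by linarith
    qed
  qed
qed

section \<open>Slow sequences in compact connected sets\<close>

text \<open>Chain \<open>k\<close> fills the indices from \<open>t k\<close> to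
  \<open>t (Suc k)\<close>. The transitive closure without reflexivity yields chains of positive
  length, hence a strictly increasing \<open>t\<close>. By \<open>anti\<close> the relations get
  finer, so all steps after \<open>t k\<close> obey \<open>R k\<close>.\<close>

lemma concatenate_chains:
  fixes R :: "nat \<Rightarrow> 'b \<Rightarrow> 'b \<Rightarrow> bool" and F :: "nat \<Rightarrow> 'b"
  assumes conn: "\<And>k. (R k)\<^sup>+\<^sup>+ (F k) (F (Suc k))"
    and anti: "\<And>k l x y. k \<le> l \<Longrightarrow> R l x y \<Longrightarrow> R k x y"
  obtains c t where "strict_mono t" "\<And>k. c (t k) = F k"
    "\<And>k i. t k \<le> i \<Longrightarrow> R k (c i) (c (Suc i))"
proof -
  have "\<exists>n p. n > 0 \<and> p 0 = F k \<and> p n = F (Suc k) \<and> (\<forall>i<n. R k (p i) (p (Suc i)))" for k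
    using conn[of k] unfolding tranclp_power relpowp_fun_conv by blast
  then obtain n p where np: "\<And>k. n k > (0::nat)" "\<And>k. p k 0 = F k" "\<And>k. p k (n k) = F (Suc k)"
    "\<And>k i. i < n k \<Longrightarrow> R k (p k i) (p k (Suc i))" by metis
  define t where "t k = (\<Sum>l<k. n l)" for k
  have t: "t 0 = 0" "t (Suc k) = t k + n k" for k by (simp_all add: t_def)
  have mono: "strict_mono t" using np(1) by (auto simp: strict_mono_Suc_iff t)
  have ex: "\<exists>k j. i = t k + j \<and> j < n k" for i
  proof (induction i)
    case 0
    then show ?case using np(1)[of 0] t(1) by (intro exI[of _ 0]) auto
  next
    case (Suc i)
    then obtain k j where kj: "i = t k + j" "j < n k" by blast
    show ?case
    proof (cases "Suc j < n k")
      case True then show ?thesis using kj by (intro exI[of _ k] exI[of _ "Suc j"]) auto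
    next
      case False
      then have "Suc i = t (Suc k) + 0" using kj by (simp add: t)
      then show ?thesis using np(1) by blast
    qed
  qed
  then obtain kk jj where kj: "\<And>i. i = t (kk i) + jj i" "\<And>i. jj i < n (kk i)" by metis
  have uniq: "k = k' \<and> j = j'" if "t k + j = t k' + j'" "j < n k" "j' < n k'" for k k' j j'
  proof -
    have "\<not> k < k'" if "t k + j = t k' + j'" "j < n k" for k k' j j'
    proof
      assume "k < k'"
      then have "t (Suc k) \<le> t k'" using mono by (simp add: strict_mono_less_eq)
      then show False using that by (simp add: t)
    qed
    then have "k = k'" using that by (metis linorder_neqE_nat)
    then show ?thesis using that by simp
  qed
  define c where "c i = p (kk i) (jj i)" for i
  have c: "c (t k + j) = p k j" if "j < n k" for k j
    using uniq[of k j "kk (t k + j)" "jj (t k + j)"] kj[of "t k + j"] that by (simp add: c_def)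
  \<comment> \<open>The case \<open>j = n k\<close> is the junction: this index belongs to chain
    \<open>Suc k\<close>, which starts where chain \<open>k\<close> ends. It is needed for the last
    step of each chain.\<close>
  have c': "c (t k + j) = p k j" if "j \<le> n k" for k j
  proof (cases "j = n k")
    case True
    then show ?thesis using c[of 0 "Suc k"] np(1,2,3) by (simp add: t)
  next
    case False
    then show ?thesis using c that by simp
  qed
  show thesis
  proof (rule that[OF mono])
    show "c (t k) = F k" for k using c[of 0 k] np by simp
    fix k i assume "t k \<le> i"
    have "k \<le> kk i"
    proof (rule ccontr)
      assume "\<not> k \<le> kk i"
      then have "t (Suc (kk i)) \<le> t k" using mono by (simp add: strict_mono_less_eq)
      then show False using kj[of i] \<open>t k \<le> i\<close> by (simp add: t)
    qed
    moreover have "R (kk i) (c i) (c (Suc i))"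
      using np(4)[OF kj(2)[of i]] c'[of "jj i" "kk i"] c'[of "Suc (jj i)" "kk i"] kj[of i] by simp
    ultimately show "R k (c i) (c (Suc i))" using anti by blast
  qed
qed

text \<open>Reachability from \<open>x\<close> by steps shorter than \<open>e\<close> is locally
  constant, since two points within \<open>e / 2\<close> of a common point are joined by one step.
  On a connected set it therefore holds everywhere.\<close>

lemma connected_chain_tranclp:
  fixes S :: "'b::metric_space set"
  assumes "connected S" "x \<in> S" "y \<in> S" "e > 0"
  shows "(\<lambda>u v. v \<in> S \<and> dist u v < e)\<^sup>+\<^sup>+ x y" (is "?R\<^sup>+\<^sup>+ x y")
proof (rule connected_induction_simple[OF assms(1-3)])
  show "?R\<^sup>+\<^sup>+ x x" using assms by auto
  fix a assume "a \<in> S"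
  have "?R\<^sup>+\<^sup>+ x v" if "u \<in> S \<inter> ball a (e / 2)" "v \<in> S \<inter> ball a (e / 2)" "?R\<^sup>+\<^sup>+ x u" for u v
  proof -
    have "dist u v < e" using that by (auto intro: dist_triangle_half_r)
    then show ?thesis using that by (intro tranclp.trancl_into_trancl[OF that(3)]) auto
  qed
  then show "\<exists>T. openin (top_of_set S) T \<and> a \<in> T \<and> (\<forall>u\<in>T. \<forall>v\<in>T. ?R\<^sup>+\<^sup>+ x u \<longrightarrow> ?R\<^sup>+\<^sup>+ x v)"
    using \<open>a \<in> S\<close> assms(4) openin_open_Int[OF open_ball, of S a "e / 2"]
    by (intro exI[of _ "S \<inter> ball a (e / 2)"] conjI ballI impI) (assumption | simp | blast)+
qed

text \<open>The union of finite nets of radius tending to 0 is countable and dense. Its members are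
  repeated infinitely often, so that every tail is dense even if \<open>S\<close> is a single
  point.\<close>

lemma compact_dense_sequence:
  fixes S :: "'b::metric_space set"
  assumes "compact S" "S \<noteq> {}"
  obtains F :: "nat \<Rightarrow> 'b" where "range F \<subseteq> S"
    "\<And>x e n. x \<in> S \<Longrightarrow> e > 0 \<Longrightarrow> \<exists>k\<ge>n. dist (F k) x < e"
proof -
  have "\<exists>N. finite N \<and> N \<subseteq> S \<and> S \<subseteq> (\<Union>x\<in>N. ball x (inverse (Suc n)))" for n
  proof -
    have "S \<subseteq> (\<Union>x\<in>S. ball x (inverse (Suc n)))" by auto
    then show ?thesis by (rule compactE_image[OF assms(1) open_ball]) auto
  qed
  then obtain N where N: "\<And>n. finite (N n)" "\<And>n. N n \<subseteq> S"
    "\<And>n. S \<subseteq> (\<Union>x\<in>N n. ball x (inverse (Suc n)))" by metis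
  define D where "D = (\<Union>n. N n)"
  have "countable D" unfolding D_def using N(1) by (auto intro: countable_finite)
  moreover have "D \<noteq> {}" using N(3)[of 0] assms(2) by (fastforce simp: D_def)
  ultimately have D: "range (from_nat_into D) = D" by (simp add: range_from_nat_into)
  \<comment> \<open>the first projection of the pairing function takes each value infinitely often\<close>
  define F where "F k = from_nat_into D (fst (prod_decode k))" for k
  show thesis
  proof (rule that[of F])
    have "from_nat_into D i \<in> D" for i using D by blast
    then show "range F \<subseteq> S" using N(2) unfolding F_def D_def by blast
    fix x e n assume "x \<in> S" "e > (0::real)"
    obtain q where q: "inverse (real (Suc q)) < e" using reals_Archimedean[OF \<open>e > 0\<close>] by blast
    obtain y where "y \<in> N q" "dist y x < inverse (real (Suc q))" using N(3)[of q] \<open>x \<in> S\<close> by auto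
    then have y: "y \<in> D" "dist y x < e" using q by (auto simp: D_def)
    obtain i where "from_nat_into D i = y" using D y(1) by (metis rangeE)
    then have "F (prod_encode (i, n)) = y" by (simp add: F_def)
    then show "\<exists>k\<ge>n. dist (F k) x < e" using y(2) le_prod_encode_2[of n i] by blast
  qed
qed

text \<open>Consecutive terms of a sequence with dense tails are joined by chains inside
  \<open>S\<close> with ever finer steps.\<close>

lemma compact_connected_slow_sequence:
  fixes S :: "'b::metric_space set"
  assumes "compact S" "connected S" "S \<noteq> {}"
  obtains c :: "nat \<Rightarrow> 'b" where "range c \<subseteq> S"
    "(\<lambda>k. dist (c k) (c (Suc k))) \<longlonglongrightarrow> 0"
    "\<And>x e n. x \<in> S \<Longrightarrow> e > 0 \<Longrightarrow> \<exists>k\<ge>n. dist (c k) x < e"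
proof -
  obtain F :: "nat \<Rightarrow> 'b" where F: "range F \<subseteq> S"
    "\<And>x e n. x \<in> S \<Longrightarrow> e > 0 \<Longrightarrow> \<exists>k\<ge>n. dist (F k) x < e"
    by (rule compact_dense_sequence[OF assms(1,3)]) blast
  define R where "R k = (\<lambda>u v. v \<in> S \<and> dist u v < inverse (real (Suc k)))" for k
  have conn: "(R k)\<^sup>+\<^sup>+ (F k) (F (Suc k))" for k
    unfolding R_def using F(1) by (intro connected_chain_tranclp[OF assms(2)]) auto
  have anti: "R k x y" if "k \<le> l" "R l x y" for k l x y
  proof -
    have "inverse (real (Suc l)) \<le> inverse (real (Suc k))" using that(1) by (intro le_imp_inverse_le) auto
    then show ?thesis using that(2) unfolding R_def by linarith
  qed
  obtain c t where ct: "strict_mono t" "\<And>k. c (t k) = F k"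
    "\<And>k i. t k \<le> i \<Longrightarrow> R k (c i) (c (Suc i))"
    using concatenate_chains[of R F] conn anti by metis
  show thesis
  \<comment> \<open>What is known about \<open>c\<close> begins at index \<open>t 0\<close>, so
    earlier terms are cut off.\<close>
  proof (rule that[of "\<lambda>i. c (i + t 0)"])
    have "c (i + t 0) \<in> S" for i
    proof (cases i)
      case 0
      then show ?thesis using ct(2)[of 0] F(1) by auto
    next
      case (Suc i')
      then show ?thesis using ct(3)[of 0 "i' + t 0"] by (simp add: R_def)
    qed
    then show "range (\<lambda>i. c (i + t 0)) \<subseteq> S" by blast
    show "(\<lambda>k. dist (c (k + t 0)) (c (Suc k + t 0))) \<longlonglongrightarrow> 0"
    proof (rule LIMSEQ_I)
      fix e :: real assume "e > 0"
      obtain q where q: "inverse (real (Suc q)) < e" using reals_Archimedean[OF \<open>e > 0\<close>] by blast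
      have "norm (dist (c (k + t 0)) (c (Suc k + t 0)) - 0) < e" if "k \<ge> t q" for k
        using ct(3)[of q "k + t 0"] that q by (simp add: R_def)
      then show "\<exists>no. \<forall>k\<ge>no. norm (dist (c (k + t 0)) (c (Suc k + t 0)) - 0) < e" by blast
    qed
    fix x e n assume "x \<in> S" "e > (0::real)"
    obtain k where k: "k \<ge> n + t 0" "dist (F k) x < e" using F(2)[OF \<open>x \<in> S\<close> \<open>e > 0\<close>] by blast
    have "t k \<ge> n + t 0" using seq_suble[OF ct(1), of k] k(1) by simp
    then show "\<exists>k\<ge>n. dist (c (k + t 0)) x < e"
      using k(2) ct(2)[of k] by (intro exI[of _ "t k - t 0"]) auto
  qed
qed

section \<open>Test functions and the weak* topology\<close>

text \<open>The hat functions around a fine finite net, divided by their sum, are a partition of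
  unity. Their combinations with rational coefficients are countably many and uniformly dense.
  Normalizing them to absolute value at most 1 is the reason for the factor
  \<open>a\<close>.\<close>

lemma compact_countable_dense_functions:
  assumes comp: "compact (UNIV :: 'a::metric_space set)"
  obtains \<phi> :: "nat \<Rightarrow> 'a::metric_space \<Rightarrow> real" where "\<And>j. continuous_on UNIV (\<phi> j)"
    "\<And>j x. \<bar>\<phi> j x\<bar> \<le> 1"
    "\<And>g e. continuous_on UNIV g \<Longrightarrow> e > 0 \<Longrightarrow> \<exists>j a. \<forall>x. \<bar>g x - a * \<phi> j x\<bar> \<le> e"
proof -
  have "\<exists>(y :: nat \<Rightarrow> 'a) r. \<forall>x. \<exists>i<r. dist (y i) x < inverse (real (Suc k))" for k
  proof -
    have "UNIV \<subseteq> (\<Union>x\<in>UNIV. ball (x :: 'a) (inverse (Suc k)))" by auto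
    then obtain N :: "'a set" where N: "finite N" "UNIV \<subseteq> (\<Union>x\<in>N. ball x (inverse (real (Suc k))))"
      by (rule compactE_image[OF comp open_ball]) blast
    obtain y :: "nat \<Rightarrow> 'a" and r where "N = y ` {i. i < r}"
      using finite_imp_nat_seg_image_inj_on[OF N(1)] by metis
    then have "\<forall>x. \<exists>i<r. dist (y i) x < inverse (real (Suc k))" using N(2) by force
    then show ?thesis by blast
  qed
  then obtain y :: "nat \<Rightarrow> nat \<Rightarrow> 'a" and r where
    yr: "\<And>k x. \<exists>i<r k. dist (y k i) x < inverse (real (Suc k))" by metis
  define w where "w k i x = max 0 (inverse (real (Suc k)) - dist (y k i) x)" for k i x
  have w_nonneg: "w k i x \<ge> 0" for k i x by (simp add: w_def)
  have W_pos: "(\<Sum>i<r k. w k i x) > 0" for k x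
  proof -
    obtain i where "i < r k" "dist (y k i) x < inverse (real (Suc k))" using yr by blast
    then show ?thesis by (intro sum_pos2[of _ i]) (auto simp: w_def)
  qed
  \<comment> \<open>The indices form a countable type. Lists that are too short give unspecified
    coefficients, but the function is still continuous and bounded.\<close>
  define \<psi> :: "nat \<times> rat list \<Rightarrow> 'a \<Rightarrow> real" where "\<psi> p x =
    (\<Sum>i<r (fst p). of_rat (snd p ! i) * w (fst p) i x) / (\<Sum>i<r (fst p). w (fst p) i x)" for p x
  have \<psi>_cont: "continuous_on UNIV (\<psi> p)" for p
    unfolding \<psi>_def[abs_def] using W_pos[of "fst p"] unfolding w_def
    by (intro continuous_intros) (auto simp: less_imp_neq[symmetric] less_imp_neq[THEN not_sym])
  have "\<exists>B>0. \<forall>x. \<bar>\<psi> p x\<bar> \<le> B" for p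
  proof -
    have "bounded (range (\<psi> p))"
      using compact_continuous_image[OF \<psi>_cont comp] by (rule compact_imp_bounded)
    then show ?thesis by (auto simp: bounded_pos)
  qed
  then obtain B where B: "\<And>p. B p > 0" "\<And>p x. \<bar>\<psi> p x\<bar> \<le> B p" by metis
  define \<phi> where "\<phi> j x = \<psi> (from_nat j) x / B (from_nat j)" for j x
  show thesis
  proof (rule that[of \<phi>])
    show "continuous_on UNIV (\<phi> j)" for j
      unfolding \<phi>_def[abs_def] using B(1)[of "from_nat j"] by (intro continuous_intros \<psi>_cont) auto
    show "\<bar>\<phi> j x\<bar> \<le> 1" for j x using B[of "from_nat j"] by (simp add: \<phi>_def abs_of_pos)
    fix g :: "'a \<Rightarrow> real" and e :: real assume g: "continuous_on UNIV g" and e: "e > 0"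
    obtain d where d: "d > 0" "\<And>x y. dist x y < d \<Longrightarrow> \<bar>g x - g y\<bar> < e / 2"
      using compact_uniformly_continuous[OF g comp] e
      unfolding uniformly_continuous_on_def dist_real_def by (metis UNIV_I half_gt_zero)
    obtain k where k: "inverse (real (Suc k)) < d" using reals_Archimedean[OF d(1)] by blast
    have "\<exists>q. \<bar>g (y k i) - of_rat q\<bar> < e / 2" for i
    proof -
      obtain q where "g (y k i) - e / 2 < of_rat q" "of_rat q < g (y k i)"
        using of_rat_dense[of "g (y k i) - e / 2" "g (y k i)"] e by auto
      then have "\<bar>g (y k i) - of_rat q\<bar> < e / 2" by linarith
      then show ?thesis by blast
    qed
    then obtain q where q: "\<And>i. \<bar>g (y k i) - of_rat (q i)\<bar> < e / 2" by metis
    define p where "p = (k, map q [0..<r k])"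
    have "\<bar>g x - \<psi> p x\<bar> \<le> e" for x
    proof -
      let ?W = "\<Sum>i<r k. w k i x"
      \<comment> \<open>Up to the total weight \<open>?W\<close>, the error is a weighted mean of
        \<open>g x - q i\<close>. Only centres within \<open>d\<close> of \<open>x\<close> carry
        weight, and for these the difference is at most \<open>e\<close>.\<close>
      have "?W * (g x - \<psi> p x) = (\<Sum>i<r k. w k i x * (g x - of_rat (q i)))"
      proof -
        have "?W * \<psi> p x = (\<Sum>i<r k. of_rat (q i) * w k i x)"
          using W_pos[of k x] by (simp add: \<psi>_def p_def)
        then have "?W * (g x - \<psi> p x) = ?W * g x - (\<Sum>i<r k. of_rat (q i) * w k i x)"
          by (simp only: right_diff_distrib)
        then show ?thesis
          unfolding sum_distrib_right right_diff_distrib sum_subtractf by (simp add: mult.commute)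
      qed
      also have "\<bar>\<dots>\<bar> \<le> (\<Sum>i<r k. w k i x * e)"
      proof (rule order.trans[OF sum_abs sum_mono])
        fix i
        show "\<bar>w k i x * (g x - of_rat (q i))\<bar> \<le> w k i x * e"
        proof (cases "dist (y k i) x < d")
          case True
          then have "\<bar>g x - of_rat (q i)\<bar> \<le> e"
            using d(2)[OF True] q[of i] by linarith
          then show ?thesis using w_nonneg by (simp add: abs_mult mult_left_mono)
        next
          case False
          then have "w k i x = 0" using k by (simp add: w_def)
          then show ?thesis by simp
        qed
      qed
      finally have "\<bar>?W * (g x - \<psi> p x)\<bar> \<le> ?W * e" by (simp only: sum_distrib_right)
      then show ?thesis using W_pos[of k x] by (simp add: abs_mult)
    qed
    then have "\<forall>x. \<bar>g x - B p * \<phi> (to_nat p) x\<bar> \<le> e"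
      using B(1)[of p] by (simp add: \<phi>_def)
    then show "\<exists>j a. \<forall>x. \<bar>g x - a * \<phi> j x\<bar> \<le> e" by blast
  qed
qed

lemma borel_probs_integrable:
  fixes g :: "'a::metric_space \<Rightarrow> real"
  assumes comp: "compact (UNIV :: 'a set)" and "\<mu> \<in> borel_probs" and g: "continuous_on UNIV g"
  shows "integrable \<mu> g"
proof -
  interpret prob_space \<mu> using assms(2) by (simp add: borel_probs_def)
  have sets: "sets \<mu> = sets borel" using assms(2) by (simp add: borel_probs_def)
  have "bounded (range g)"
    using compact_continuous_image[OF g comp] by (rule compact_imp_bounded)
  then obtain B where "\<forall>x. \<bar>g x\<bar> \<le> B" by (auto simp: bounded_iff)
  moreover have "g \<in> borel_measurable \<mu>"
    unfolding measurable_cong_sets[OF sets refl] by (intro borel_measurable_continuous_onI g)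
  ultimately show ?thesis by (intro integrable_const_bound[of _ B]) auto
qed

text \<open>The indicator of a closed set \<open>F\<close> is the limit of the continuous functions
  \<open>max 0 (1 - n * infdist x F)\<close>, so the integrals determine the measure of closed sets.
  These generate the Borel sets and are stable under intersection.\<close>

lemma borel_probs_eqI:
  fixes \<mu> \<nu> :: "'a::metric_space measure"
  assumes \<mu>: "\<mu> \<in> borel_probs" and \<nu>: "\<nu> \<in> borel_probs"
    and eq: "\<And>g :: 'a \<Rightarrow> real. continuous_on UNIV g \<Longrightarrow> (LINT x|\<mu>. g x) = (LINT x|\<nu>. g x)"
  shows "\<mu> = \<nu>"
proof -
  \<comment> \<open>By convention \<open>infdist x {} = 0\<close>, so for empty \<open>F\<close> the
    approximants would be constantly 1; that case is treated apart.\<close>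
  have closed_lim: "(\<lambda>n. LINT x|\<rho>. max 0 (1 - real n * infdist x F)) \<longlonglongrightarrow> measure \<rho> F"
    if "\<rho> \<in> borel_probs" "closed F" "F \<noteq> {}" for \<rho> and F :: "'a set"
  proof -
    interpret prob_space \<rho> using that by (simp add: borel_probs_def)
    have sets: "sets \<rho> = sets borel" using that by (simp add: borel_probs_def)
    have meas: "(\<lambda>x. max 0 (1 - real n * infdist x F)) \<in> borel_measurable \<rho>" for n
      unfolding measurable_cong_sets[OF sets refl]
      by (intro borel_measurable_continuous_onI continuous_intros)
    have F: "F \<in> sets \<rho>" using that by (simp add: sets)
    have "(\<lambda>n. LINT x|\<rho>. max 0 (1 - real n * infdist x F)) \<longlonglongrightarrow> (LINT x|\<rho>. indicator F x)"
    proof (rule integral_dominated_convergence[where w = "\<lambda>_. 1"])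
      show "AE x in \<rho>. (\<lambda>n. max 0 (1 - real n * infdist x F)) \<longlonglongrightarrow> indicator F x"
      proof (rule AE_I2)
        fix x
        show "(\<lambda>n. max 0 (1 - real n * infdist x F)) \<longlonglongrightarrow> indicator F x"
        proof (cases "x \<in> F")
          case False
          then have pos: "infdist x F > 0"
            using that in_closed_iff_infdist_zero[of F x] infdist_nonneg[of x F] by linarith
          obtain n0 where n0: "1 / infdist x F < real n0" using reals_Archimedean2 by blast
          have "max 0 (1 - real n * infdist x F) = 0" if "n \<ge> n0" for n
          proof -
            have "1 / infdist x F \<le> real n" using that n0 by linarith
            then show ?thesis using pos by (simp add: field_simps)
          qed
          then have "\<forall>\<^sub>F n in sequentially. max 0 (1 - real n * infdist x F) = 0"
            by (auto simp: eventually_sequentially)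
          then show ?thesis using False by (simp add: tendsto_eventually)
        qed simp
      qed
    qed (use F meas in \<open>auto intro!: AE_I2 mult_nonneg_nonneg infdist_nonneg\<close>)
    then show ?thesis using F by simp
  qed
  show ?thesis
  proof (rule measure_eqI_generator_eq[where E = "Collect closed" and \<Omega> = UNIV and A = "\<lambda>_. UNIV"])
    interpret \<mu>: prob_space \<mu> using \<mu> by (simp add: borel_probs_def)
    interpret \<nu>: prob_space \<nu> using \<nu> by (simp add: borel_probs_def)
    show "Int_stable (Collect closed)" by (auto simp: Int_stable_def)
    have sets: "sets \<mu> = sets borel" "sets \<nu> = sets borel" using \<mu> \<nu> by (auto simp: borel_probs_def)
    then show "sets \<mu> = sigma_sets UNIV (Collect closed)" "sets \<nu> = sigma_sets UNIV (Collect closed)"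
      by (simp_all add: borel_eq_closed)
    show "emeasure \<mu> UNIV \<noteq> \<infinity>" for i :: nat by simp
    fix F :: "'a set" assume "F \<in> Collect closed"
    then have F: "closed F" by simp
    show "emeasure \<mu> F = emeasure \<nu> F"
    proof (cases "F = {}")
      case False
      have "(LINT x|\<mu>. max 0 (1 - real n * infdist x F)) = (LINT x|\<nu>. max 0 (1 - real n * infdist x F))" for n
        by (intro eq continuous_intros)
      then have "measure \<mu> F = measure \<nu> F"
        using closed_lim[OF \<mu> F False] closed_lim[OF \<nu> F False] by (simp add: LIMSEQ_unique)
      then show ?thesis by (simp add: \<mu>.emeasure_eq_measure \<nu>.emeasure_eq_measure)
    qed simp
  qed auto
qed

text \<open>As the image of the uniform distribution on times, the empirical measure has integrals
  that reduce to finite sums.\<close>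

lemma empirical_eq_distr:
  assumes "n > 0"
  shows "empirical f n x = distr (measure_pmf (pmf_of_set {..<n})) borel (\<lambda>i. (f ^^ i) x)"
proof (rule measure_eqI)
  fix A assume "A \<in> sets (empirical f n x)"
  then have A: "A \<in> sets borel" by simp
  have "emeasure (distr (measure_pmf (pmf_of_set {..<n})) borel (\<lambda>i. (f ^^ i) x)) A
      = emeasure (measure_pmf (pmf_of_set {..<n})) ((\<lambda>i. (f ^^ i) x) -` A)"
    using A by (simp add: emeasure_distr)
  also have "\<dots> = ennreal (real (card ({..<n} \<inter> (\<lambda>i. (f ^^ i) x) -` A)) / real n)"
    using assms by (subst emeasure_pmf_of_set) (auto simp: lessThan_empty_iff)
  also have "\<dots> = 1 / of_nat n * of_nat (card ({..<n} \<inter> (\<lambda>i. (f ^^ i) x) -` A))"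
    using assms
    by (subst mult.commute)
      (simp add: divide_ennreal[symmetric] ennreal_of_nat_eq_real_of_nat ennreal_times_divide)
  also have "of_nat (card ({..<n} \<inter> (\<lambda>i. (f ^^ i) x) -` A)) = (\<Sum>i<n. emeasure (return borel ((f ^^ i) x)) A)"
    using A by (simp add: indicator_def sum.If_cases Int_def vimage_def)
  finally show "emeasure (empirical f n x) A
      = emeasure (distr (measure_pmf (pmf_of_set {..<n})) borel (\<lambda>i. (f ^^ i) x)) A"
    using A by (simp add: emeasure_empirical)
qed simp

lemma integral_empirical:
  fixes g :: "'a::metric_space \<Rightarrow> real"
  assumes "n > 0" "continuous_on UNIV g"
  shows "(LINT y|empirical f n x. g y) = (\<Sum>i<n. g ((f ^^ i) x)) / real n"
proof -
  have "(LINT y|empirical f n x. g y) = (LINT i|measure_pmf (pmf_of_set {..<n}). g ((f ^^ i) x))"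
    unfolding empirical_eq_distr[OF assms(1)]
    by (intro integral_distr) (auto intro: borel_measurable_continuous_onI assms(2))
  also have "\<dots> = (\<Sum>i<n. g ((f ^^ i) x)) / real n"
    using assms(1) by (subst integral_pmf_of_set) (auto simp: lessThan_empty_iff)
  finally show ?thesis .
qed

text \<open>Convergence only has to be tested on the generating sets. Membership is asked for
  eventually because the empirical measure at time 0 is the zero measure.\<close>

lemma limitin_weak_star_iff:
  fixes M :: "'b \<Rightarrow> 'a::metric_space measure"
  assumes M: "\<forall>\<^sub>F n in F. M n \<in> borel_probs"
  shows "limitin weak_star M \<mu> F \<longleftrightarrow> \<mu> \<in> borel_probs \<and>
    (\<forall>g. continuous_on UNIV g \<longrightarrow> ((\<lambda>n. LINT x|M n. g x) \<longlongrightarrow> (LINT x|\<mu>. (g x :: real))) F)"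
    (is "_ \<longleftrightarrow> _ \<and> ?R")
proof (intro iffI conjI allI impI)
  assume L: "limitin weak_star M \<mu> F"
  then show \<mu>: "\<mu> \<in> borel_probs" by (simp add: limitin_def)
  fix g :: "'a \<Rightarrow> real" assume g: "continuous_on UNIV g"
  show "((\<lambda>n. LINT x|M n. g x) \<longlongrightarrow> (LINT x|\<mu>. g x)) F"
  proof (rule topological_tendstoI)
    fix V :: "real set" assume V: "open V" "(LINT x|\<mu>. g x) \<in> V"
    have "openin weak_star {\<mu> \<in> borel_probs. (LINT x|\<mu>. g x) \<in> V}"
      unfolding weak_star_def using g V by (intro topology_generated_by_Basis) blast
    then have "\<forall>\<^sub>F n in F. M n \<in> {\<mu> \<in> borel_probs. (LINT x|\<mu>. g x) \<in> V}"
      using L V(2) \<mu> by (auto simp: limitin_def)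
    then show "\<forall>\<^sub>F n in F. (LINT x|M n. g x) \<in> V" by (rule eventually_mono) simp
  qed
next
  assume R: "\<mu> \<in> borel_probs \<and> ?R"
  have "\<forall>\<^sub>F n in F. M n \<in> W" if "openin weak_star W" "\<mu> \<in> W" for W
    using that(1)[unfolded weak_star_def openin_topology_generated_by_iff] that(2)
  proof (induction rule: generate_topology_on.induct)
    case (Int a b)
    then show ?case by (auto intro: eventually_conj)
  next
    case (UN K)
    then obtain k where "k \<in> K" "\<mu> \<in> k" by blast
    then have "\<forall>\<^sub>F n in F. M n \<in> k" using UN by blast
    then show ?case using \<open>k \<in> K\<close> by (auto elim: eventually_mono)
  next
    case (Basis s)
    then obtain g :: "'a \<Rightarrow> real" and V where s: "s = {\<mu> \<in> borel_probs. (LINT x|\<mu>. g x) \<in> V}"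
      and g: "continuous_on UNIV g" and V: "open V" by blast
    have "((\<lambda>n. LINT x|M n. g x) \<longlongrightarrow> (LINT x|\<mu>. g x)) F" using R g by blast
    then have "\<forall>\<^sub>F n in F. (LINT x|M n. g x) \<in> V"
      using V Basis.prems s by (auto dest: topological_tendstoD)
    then show ?case using M unfolding s by eventually_elim simp
  qed simp
  then show "limitin weak_star M \<mu> F" using R by (simp add: limitin_def)
qed

text \<open>Replacing \<open>g\<close> by \<open>a * \<phi> j\<close> changes the integral against
  any Borel probability measure by at most \<open>e / 3\<close>, hence uniformly in
  \<open>n\<close>.\<close>

lemma tendsto_integral_dense:
  fixes \<phi> :: "nat \<Rightarrow> 'a::metric_space \<Rightarrow> real" and g :: "'a \<Rightarrow> real"
  assumes comp: "compact (UNIV :: 'a set)" and \<phi>: "\<And>j. continuous_on UNIV (\<phi> j)"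
    and dense: "\<And>(g :: 'a \<Rightarrow> real) e. continuous_on UNIV g \<Longrightarrow> e > 0 \<Longrightarrow>
      \<exists>j a. \<forall>x. \<bar>g x - a * \<phi> j x\<bar> \<le> e"
    and M: "\<forall>\<^sub>F n in F. M n \<in> borel_probs" and \<mu>: "\<mu> \<in> borel_probs"
    and lim: "\<And>j. ((\<lambda>n. LINT x|M n. \<phi> j x) \<longlongrightarrow> (LINT x|\<mu>. \<phi> j x)) F"
    and g: "continuous_on UNIV g"
  shows "((\<lambda>n. LINT x|M n. g x) \<longlongrightarrow> (LINT x|\<mu>. g x)) F"
proof (rule tendstoI)
  fix e :: real assume "e > 0"
  then obtain j a where ja: "\<And>x. \<bar>g x - a * \<phi> j x\<bar> \<le> e / 3"
    using dense[OF g, of "e / 3"] by auto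
  have approx: "\<bar>(LINT x|\<nu>. g x) - a * (LINT x|\<nu>. \<phi> j x)\<bar> \<le> e / 3" if "\<nu> \<in> borel_probs" for \<nu>
  proof -
    interpret prob_space \<nu> using that by (simp add: borel_probs_def)
    have int: "integrable \<nu> g" "integrable \<nu> (\<phi> j)"
      using borel_probs_integrable[OF comp that] g \<phi> by auto
    have "(LINT x|\<nu>. g x) - a * (LINT x|\<nu>. \<phi> j x) = (LINT x|\<nu>. g x - a * \<phi> j x)"
      using int by simp
    also have "\<bar>\<dots>\<bar> \<le> (LINT x|\<nu>. \<bar>g x - a * \<phi> j x\<bar>)" by (rule integral_abs_bound)
    also have "\<dots> \<le> (LINT x|\<nu>. e / 3)" using int ja by (intro integral_mono) auto
    finally show ?thesis by (simp add: prob_space)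
  qed
  have "((\<lambda>n. a * (LINT x|M n. \<phi> j x)) \<longlongrightarrow> a * (LINT x|\<mu>. \<phi> j x)) F"
    by (intro tendsto_intros lim)
  then have "\<forall>\<^sub>F n in F. dist (a * (LINT x|M n. \<phi> j x)) (a * (LINT x|\<mu>. \<phi> j x)) < e / 3"
    using \<open>e > 0\<close> by (intro tendstoD) auto
  then show "\<forall>\<^sub>F n in F. dist (LINT x|M n. g x) (LINT x|\<mu>. g x) < e"
    using M
  proof eventually_elim
    case (elim n)
    then show ?case using approx[OF elim(2)] approx[OF \<mu>] unfolding dist_real_def by linarith
  qed
qed

section \<open>Transitive saturated points\<close>

lemma tendsto_fun_iff:
  fixes c :: "'b \<Rightarrow> 'c \<Rightarrow> 'd::topological_space"
  shows "(c \<longlongrightarrow> l) F \<longleftrightarrow> (\<forall>j. ((\<lambda>k. c k j) \<longlongrightarrow> l j) F)"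
  using limitin_componentwise[of "\<lambda>_::'c. euclidean :: 'd topology" UNIV c l F]
  by (simp add: euclidean_product_topology)

lemma ex_subsequence_tendsto:
  fixes c :: "nat \<Rightarrow> 'b::metric_space"
  assumes "\<And>e n. e > 0 \<Longrightarrow> \<exists>k\<ge>n. dist (c k) x < e"
  obtains r :: "nat \<Rightarrow> nat" where "strict_mono r" "(\<lambda>k. c (r k)) \<longlonglongrightarrow> x"
proof -
  have "\<exists>r. \<forall>n. dist (c (r n)) x < inverse (real (Suc n)) \<and> r n < r (Suc n)"
  proof (rule dependent_nat_choice)
    show "\<exists>k. dist (c k) x < inverse (real (Suc 0))" using assms[of 1 0] by auto
    fix k n
    show "\<exists>k'. dist (c k') x < inverse (real (Suc (Suc n))) \<and> k < k'"
      using assms[of "inverse (real (Suc (Suc n)))" "Suc k"] by (auto simp: Suc_le_eq)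
  qed
  then obtain r where r: "\<And>n. dist (c (r n)) x < inverse (real (Suc n))" "strict_mono r"
    by (auto simp: strict_mono_Suc_iff)
  have "(\<lambda>k. dist (c (r k)) x) \<longlonglongrightarrow> 0"
  proof (rule tendsto_sandwich[OF _ _ tendsto_const LIMSEQ_inverse_real_of_nat])
    show "\<forall>\<^sub>F k in sequentially. dist (c (r k)) x \<le> inverse (real (Suc k))"
      by (intro always_eventually allI less_imp_le r(1))
  qed simp
  then have "(\<lambda>k. c (r k)) \<longlonglongrightarrow> x" by (rule tendsto_dist_iff[THEN iffD2])
  then show thesis by (rule that[OF r(2)])
qed

lemma limit_measures_eqI:
  fixes f :: "'a::metric_space \<Rightarrow> 'a" and \<phi> :: "nat \<Rightarrow> 'a \<Rightarrow> real"
  assumes comp: "compact (UNIV :: 'a set)"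
    and \<phi>: "\<And>j. continuous_on UNIV (\<phi> j)"
    and dense: "\<And>g e. continuous_on UNIV g \<Longrightarrow> e > 0 \<Longrightarrow> \<exists>j a. \<forall>x. \<bar>g x - a * \<phi> j x\<bar> \<le> e"
    and K: "K \<subseteq> borel_probs"
    and \<Phi>: "\<Phi> = (\<lambda>\<mu> j. LINT x|\<mu>. \<phi> j x)"
    and closed: "closed (\<Phi> ` K)"
    and c: "range c \<subseteq> \<Phi> ` K" "\<And>y e n. y \<in> \<Phi> ` K \<Longrightarrow> e > 0 \<Longrightarrow> \<exists>k\<ge>n. dist (c k) y < e"
    and T: "strict_mono T"
    and approx: "\<And>j e. e > 0 \<Longrightarrow> \<exists>k0. \<forall>k\<ge>k0. \<forall>n\<in>{T k..T (Suc k)}.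
       \<bar>\<Sum>i<n. \<phi> j ((f ^^ i) z) - c k j\<bar> \<le> e * real n"
  shows "limit_measures f z = K"
proof -
  have emp_probs: "\<forall>\<^sub>F k in sequentially. empirical f (r k) z \<in> borel_probs" if "strict_mono r" for r
    using eventually_gt_at_top[of 0]
  proof eventually_elim
    case (elim k)
    then show ?case using seq_suble[OF that, of k] by (intro empirical_in_borel_probs) simp
  qed
  have approx': "\<exists>k0. \<forall>k\<ge>k0. \<forall>n\<in>{T k..T (Suc k)}. dist (LINT x|empirical f n z. \<phi> j x) (c k j) \<le> e"
    if e: "e > 0" for j e
  proof -
    obtain k0 where k0: "\<And>k n. k \<ge> k0 \<Longrightarrow> n \<in> {T k..T (Suc k)} \<Longrightarrow>
       \<bar>\<Sum>i<n. \<phi> j ((f ^^ i) z) - c k j\<bar> \<le> e * real n" using approx[OF e] by blast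
    have "dist (LINT x|empirical f n z. \<phi> j x) (c k j) \<le> e"
      \<comment> \<open>\<open>Suc k0\<close> forces \<open>k > 0\<close>, hence
        \<open>n \<ge> T k \<ge> k > 0\<close>.\<close>
      if "k \<ge> Suc k0" "n \<in> {T k..T (Suc k)}" for k n
    proof -
      have n: "n > 0" using seq_suble[OF T, of k] that by auto
      then have "(LINT x|empirical f n z. \<phi> j x) - c k j = (\<Sum>i<n. \<phi> j ((f ^^ i) z) - c k j) / real n"
        by (simp add: integral_empirical[OF n \<phi>] sum_subtractf diff_divide_distrib)
      also have "\<bar>\<dots>\<bar> \<le> e" using k0[of k n] that n by (simp add: pos_divide_le_eq)
      finally show ?thesis by (simp add: dist_real_def)
    qed
    then show ?thesis by blast
  qed
  show ?thesis
  proof (intro equalityI subsetI)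
    fix \<mu> assume "\<mu> \<in> K"
    then have \<mu>: "\<mu> \<in> borel_probs" "\<Phi> \<mu> \<in> \<Phi> ` K" using K by auto
    obtain r where r: "strict_mono r" "(\<lambda>k. c (r k)) \<longlonglongrightarrow> \<Phi> \<mu>"
      by (rule ex_subsequence_tendsto[of c "\<Phi> \<mu>"]) (use c(2)[OF \<mu>(2)] in blast)+
    have Tr: "strict_mono (\<lambda>k. T (r k))" using T r(1) by (simp add: strict_mono_def)
    have "(\<lambda>k. LINT x|empirical f (T (r k)) z. \<phi> j x) \<longlonglongrightarrow> (LINT x|\<mu>. \<phi> j x)" for j
    proof -
      have "(\<lambda>k. (LINT x|empirical f (T (r k)) z. \<phi> j x) - c (r k) j) \<longlonglongrightarrow> 0"
      proof (rule LIMSEQ_I)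
        fix e :: real assume "e > 0"
        from approx'[OF half_gt_zero[OF this], of j]
        obtain k0 where k0: "\<And>k n. k \<ge> k0 \<Longrightarrow> n \<in> {T k..T (Suc k)} \<Longrightarrow>
            dist (LINT x|empirical f n z. \<phi> j x) (c k j) \<le> e / 2" by blast
        have "norm ((LINT x|empirical f (T (r k)) z. \<phi> j x) - c (r k) j - 0) < e" if "k \<ge> k0" for k
        proof -
          have "k0 \<le> r k" using seq_suble[OF r(1), of k] that by simp
          then have "dist (LINT x|empirical f (T (r k)) z. \<phi> j x) (c (r k) j) \<le> e / 2"
            using T by (intro k0) (auto simp: strict_mono_less_eq)
          then show ?thesis using \<open>e > 0\<close> by (simp add: dist_real_def)
        qed
        then show "\<exists>no. \<forall>k\<ge>no. norm ((LINT x|empirical f (T (r k)) z. \<phi> j x) - c (r k) j - 0) < e" by blast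
      qed
      moreover have "(\<lambda>k. c (r k) j) \<longlonglongrightarrow> (LINT x|\<mu>. \<phi> j x)"
        using r(2) unfolding tendsto_fun_iff \<Phi> by blast
      ultimately show ?thesis using tendsto_add by fastforce
    qed
    then have "limitin weak_star (\<lambda>k. empirical f (T (r k)) z) \<mu> sequentially"
      unfolding limitin_weak_star_iff[OF emp_probs[OF Tr]]
      using tendsto_integral_dense[OF comp \<phi> dense emp_probs[OF Tr] \<mu>(1)] \<mu>(1) by blast
    then show "\<mu> \<in> limit_measures f z" unfolding limit_measures_def using Tr by blast
  next
    fix \<mu> assume "\<mu> \<in> limit_measures f z"
    then obtain r where r: "strict_mono r" "limitin weak_star (\<lambda>k. empirical f (r k) z) \<mu> sequentially"
      unfolding limit_measures_def by blast
    have \<mu>: "\<mu> \<in> borel_probs"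
      and lim: "\<And>j. (\<lambda>k. LINT x|empirical f (r k) z. \<phi> j x) \<longlonglongrightarrow> (LINT x|\<mu>. \<phi> j x)"
      using r(2) \<phi> unfolding limitin_weak_star_iff[OF emp_probs[OF r(1)]] by blast+
    \<comment> \<open>The shift by \<open>T 0\<close> skips the times before the first
      stage.\<close>
    have "\<exists>k. T k \<le> r (i + T 0) \<and> r (i + T 0) < T (Suc k)" for i
    proof -
      let ?n = "r (i + T 0)"
      have "T 0 \<le> ?n" using seq_suble[OF r(1), of "i + T 0"] by simp
      have fin: "finite {k. T k \<le> ?n}"
        using finite_subset[of "{k. T k \<le> ?n}" "{..?n}"] seq_suble[OF T] order.trans by blast
      define k where "k = Max {k. T k \<le> ?n}"
      have "T k \<le> ?n" using Max_in[OF fin] \<open>T 0 \<le> ?n\<close> unfolding k_def by blast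
      moreover have "\<not> T (Suc k) \<le> ?n" using Max_ge[OF fin, of "Suc k"] unfolding k_def by auto
      ultimately show ?thesis by (auto simp: not_le)
    qed
    then obtain \<kappa> where \<kappa>: "\<And>i. T (\<kappa> i) \<le> r (i + T 0)" "\<And>i. r (i + T 0) < T (Suc (\<kappa> i))" by metis
    have "\<forall>\<^sub>F i in sequentially. \<kappa> i \<ge> k" for k
      using eventually_ge_at_top[of "T k"]
    proof eventually_elim
      case (elim i)
      then have "T k < T (Suc (\<kappa> i))" using seq_suble[OF r(1), of "i + T 0"] \<kappa>(2)[of i] by linarith
      then show ?case using T by (simp add: strict_mono_less less_Suc_eq_le)
    qed
    then have \<kappa>_lim: "filterlim \<kappa> at_top sequentially" by (simp add: filterlim_at_top)
    have "(\<lambda>i. c (\<kappa> i) j) \<longlonglongrightarrow> \<Phi> \<mu> j" for j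
    proof -
      have "(\<lambda>i. c (\<kappa> i) j - (LINT x|empirical f (r (i + T 0)) z. \<phi> j x)) \<longlonglongrightarrow> 0"
      proof (rule tendstoI)
        fix e :: real assume "e > 0"
        from approx'[OF half_gt_zero[OF this], of j]
        obtain k0 where k0: "\<And>k n. k \<ge> k0 \<Longrightarrow> n \<in> {T k..T (Suc k)} \<Longrightarrow>
            dist (LINT x|empirical f n z. \<phi> j x) (c k j) \<le> e / 2" by blast
        have "\<forall>\<^sub>F i in sequentially. k0 \<le> \<kappa> i" using \<kappa>_lim by (simp add: filterlim_at_top)
        then show "\<forall>\<^sub>F i in sequentially.
            dist (c (\<kappa> i) j - (LINT x|empirical f (r (i + T 0)) z. \<phi> j x)) 0 < e"
        proof eventually_elim
          case (elim i)
          then have "dist (LINT x|empirical f (r (i + T 0)) z. \<phi> j x) (c (\<kappa> i) j) \<le> e / 2"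
            using \<kappa>[of i] by (intro k0) auto
          then show ?case using \<open>e > 0\<close> by (simp add: dist_real_def abs_minus_commute)
        qed
      qed
      moreover have "(\<lambda>i. LINT x|empirical f (r (i + T 0)) z. \<phi> j x) \<longlonglongrightarrow> \<Phi> \<mu> j"
        using LIMSEQ_ignore_initial_segment[OF lim[of j], of "T 0"] by (simp add: \<Phi>)
      ultimately show ?thesis using tendsto_add by fastforce
    qed
    then have "(\<lambda>i. c (\<kappa> i)) \<longlonglongrightarrow> \<Phi> \<mu>" unfolding tendsto_fun_iff[of "\<lambda>i. c (\<kappa> i)"] by blast
    from closed_sequentially[OF closed _ this] have "\<Phi> \<mu> \<in> \<Phi> ` K" using c(1) by blast
    then obtain \<nu> where \<nu>: "\<nu> \<in> K" "\<And>j. (LINT x|\<nu>. \<phi> j x) = (LINT x|\<mu>. \<phi> j x)"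
      unfolding \<Phi> by (metis (no_types, lifting) imageE)
    have "(LINT x|\<nu>. g x) = (LINT x|\<mu>. g x)" if "continuous_on UNIV g" for g :: "'a \<Rightarrow> real"
    proof -
      have "((\<lambda>n::nat. LINT x|\<nu>. g x) \<longlongrightarrow> (LINT x|\<mu>. g x)) sequentially"
        using \<nu> K by (intro tendsto_integral_dense[OF comp \<phi> dense _ \<mu> _ that]) auto
      then show ?thesis by (simp add: tendsto_const_iff)
    qed
    then have "\<nu> = \<mu>" using \<nu>(1) K \<mu> by (intro borel_probs_eqI) auto
    then show "\<mu> \<in> K" using \<nu>(1) by simp
  qed
qed

text \<open>Each coordinate is continuous because preimages of open sets are generators of the weak*
  topology.\<close>

lemma compact_connected_integrals:
  fixes \<phi> :: "nat \<Rightarrow> 'a::metric_space \<Rightarrow> real"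
  assumes \<phi>: "\<And>j. continuous_on UNIV (\<phi> j)"
    and K: "compactin weak_star K" "connectedin weak_star K"
  shows "compact ((\<lambda>\<mu> j. LINT x|\<mu>. \<phi> j x) ` K)" "connected ((\<lambda>\<mu> j. LINT x|\<mu>. \<phi> j x) ` K)"
proof -
  have "continuous_map weak_star euclideanreal (\<lambda>\<mu>. LINT x|\<mu>. \<phi> j x)" for j
  proof (rule continuous_map_openin_preimage_eq[THEN iffD2], intro conjI allI impI)
    fix V :: "real set" assume "openin euclideanreal V"
    then have "openin weak_star {\<mu> \<in> borel_probs. (LINT x|\<mu>. \<phi> j x) \<in> V}"
      unfolding weak_star_def using \<phi>[of j] by (intro topology_generated_by_Basis) auto
    moreover have "{\<mu> \<in> borel_probs. (LINT x|\<mu>. \<phi> j x) \<in> V} = borel_probs \<inter> (\<lambda>\<mu>. LINT x|\<mu>. \<phi> j x) -` V"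
      by auto
    ultimately show "openin weak_star (topspace weak_star \<inter> (\<lambda>\<mu>. LINT x|\<mu>. \<phi> j x) -` V)" by simp
  qed simp
  then have "continuous_map weak_star euclidean (\<lambda>\<mu> j. LINT x|\<mu>. \<phi> j x)"
    unfolding euclidean_product_topology[symmetric] by (intro continuous_map_coordinatewise_then_product) auto
  from image_compactin[OF K(1) this] connectedin_continuous_map_image[OF this K(2)]
  show "compact ((\<lambda>\<mu> j. LINT x|\<mu>. \<phi> j x) ` K)" "connected ((\<lambda>\<mu> j. LINT x|\<mu>. \<phi> j x) ` K)" by simp_all
qed

text \<open>Specification is first used to start in \<open>U\<close> at time 0 and, after the gap,
  to follow \<open>x\<close>. The tower then starts from this point and keeps its first
  \<open>1 + m + n\<close> iterates. The delay \<open>1 + m\<close> depends on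
  \<open>\<epsilon>\<close> and \<open>U\<close> but not on \<open>x\<close> or
  \<open>n\<close>.\<close>

lemma transitive_saturated_shadowing:
  fixes f :: "'a::metric_space \<Rightarrow> 'a"
  assumes "TDS f" and spec: "specification_property f"
    and K: "K \<subseteq> invariant_probs f" "K \<noteq> {}" "compactin weak_star K" "connectedin weak_star K"
    and U: "open U" "U \<noteq> {}" and \<epsilon>: "\<epsilon> > 0"
  obtains N where "\<And>x n. \<exists>z\<in>transitive_saturated_set f K U.
    \<forall>i<n. dist ((f ^^ i) x) ((f ^^ (N + i)) z) < \<epsilon>"
proof -
  have comp: "compact (UNIV :: 'a set)" and cont: "continuous_on UNIV f"
    using assms(1) by (auto simp: TDS_def homeomorphism_def)
  obtain \<phi> :: "nat \<Rightarrow> 'a \<Rightarrow> real" where \<phi>: "\<And>j. continuous_on UNIV (\<phi> j)" "\<And>j x. \<bar>\<phi> j x\<bar> \<le> 1"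
    and dense: "\<And>g e. continuous_on UNIV g \<Longrightarrow> e > 0 \<Longrightarrow> \<exists>j a. \<forall>x. \<bar>g x - a * \<phi> j x\<bar> \<le> e"
    by (rule compact_countable_dense_functions[OF comp]) blast
  define \<Phi> where "\<Phi> = (\<lambda>(\<mu> :: 'a measure) j. LINT x|\<mu>. \<phi> j x)"
  have C: "compact (\<Phi> ` K)" "connected (\<Phi> ` K)" "\<Phi> ` K \<noteq> {}"
    using compact_connected_integrals[OF \<phi>(1) K(3,4)] K(2) by (simp_all add: \<Phi>_def)
  obtain c where c: "range c \<subseteq> \<Phi> ` K" "(\<lambda>k. dist (c k) (c (Suc k))) \<longlonglongrightarrow> 0"
    "\<And>x e n. x \<in> \<Phi> ` K \<Longrightarrow> e > 0 \<Longrightarrow> \<exists>k\<ge>n. dist (c k) x < e"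
    by (rule compact_connected_slow_sequence[OF C]) blast
  have "\<exists>\<mu>. \<mu> \<in> K \<and> \<Phi> \<mu> = c k" for k
  proof -
    have "c k \<in> \<Phi> ` K" using c(1) by blast
    then show ?thesis by auto
  qed
  then obtain \<alpha> where \<alpha>: "\<And>k. \<alpha> k \<in> K" "\<And>k. \<Phi> (\<alpha> k) = c k" by metis
  have c_eq: "c k j = (LINT x|\<alpha> k. \<phi> j x)" for k j using \<alpha>(2)[of k] by (simp add: \<Phi>_def fun_eq_iff)
  have drift: "(\<lambda>k. (LINT x|\<alpha> (Suc k). \<phi> j x) - (LINT x|\<alpha> k. \<phi> j x)) \<longlonglongrightarrow> 0" for j
  proof -
    \<comment> \<open>Small steps of \<open>c\<close> in the product metric become small in each
      coordinate by uniform continuity on the compact image.\<close>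
    have unif: "uniformly_continuous_on (\<Phi> ` K) (\<lambda>y. y j)"
      by (intro compact_uniformly_continuous[OF _ C(1)]
          continuous_on_subset[OF continuous_on_product_coordinates]) simp
    show ?thesis
    proof (rule LIMSEQ_I)
      fix e :: real assume "e > 0"
      then obtain d where d: "d > 0" "\<And>y y'. y \<in> \<Phi> ` K \<Longrightarrow> y' \<in> \<Phi> ` K \<Longrightarrow> dist y' y < d \<Longrightarrow> dist (y' j) (y j) < e"
        using unif unfolding uniformly_continuous_on_def by metis
      obtain k0 where k0: "\<And>k. k \<ge> k0 \<Longrightarrow> dist (c k) (c (Suc k)) < d"
        using LIMSEQ_D[OF c(2) d(1)] by auto
      have "norm ((LINT x|\<alpha> (Suc k). \<phi> j x) - (LINT x|\<alpha> k. \<phi> j x) - 0) < e" if "k \<ge> k0" for k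
      proof -
        have "c i \<in> \<Phi> ` K" for i using c(1) by blast
        moreover have "dist (c (Suc k)) (c k) < d" using k0[OF that] by (simp only: dist_commute)
        ultimately have "dist (c (Suc k) j) (c k j) < e" by (intro d(2))
        then show ?thesis by (simp only: c_eq dist_real_def real_norm_def diff_0_right)
      qed
      then show "\<exists>no. \<forall>k\<ge>no. norm ((LINT x|\<alpha> (Suc k). \<phi> j x) - (LINT x|\<alpha> k. \<phi> j x) - 0) < e" by blast
    qed
  qed
  obtain u \<rho> where u: "\<rho> > 0" "ball u \<rho> \<subseteq> U" using U by (metis openE ex_in_conv)
  \<comment> \<open>Two errors of size \<open>\<delta>\<close> must fit into both
    \<open>\<epsilon>\<close> and the radius \<open>\<rho>\<close>.\<close>
  define \<delta> where "\<delta> = min \<epsilon> \<rho> / 3"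
  have \<delta>: "\<delta> > 0" "2 * \<delta> < \<epsilon>" "2 * \<delta> < \<rho>" using u(1) \<epsilon> by (auto simp: \<delta>_def min_def)
  obtain m where m: "\<And>z T N J xs. T > 0 \<Longrightarrow> N > 0 \<Longrightarrow>
       \<exists>z'. (\<forall>i<T. dist ((f ^^ i) z) ((f ^^ i) z') < \<delta>) \<and>
            (\<forall>j<J. \<forall>i<N. dist ((f ^^ i) (xs j)) ((f ^^ (T + (j * (N + m) + m + i))) z') < \<delta>)"
    by (rule specification_glue[OF spec \<delta>(1)]) blast
  show thesis
  proof (rule that[of "1 + m"])
    fix x n
    \<comment> \<open>The segment has length \<open>Suc n\<close>, as gluing asks for a positive
      length and \<open>n\<close> may be 0.\<close>
    obtain z0 where z0: "dist u z0 < \<delta>"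
      "\<And>i. i < Suc n \<Longrightarrow> dist ((f ^^ i) x) ((f ^^ (1 + m + i)) z0) < \<delta>"
      using m[of 1 "Suc n" u 1 "\<lambda>_. x"] by auto
    obtain z T where z: "strict_mono T" "omega_limit f z = UNIV"
      "\<And>i. i < 1 + m + n \<Longrightarrow> dist ((f ^^ i) z0) ((f ^^ i) z) \<le> \<delta>"
      "\<And>j e. e > 0 \<Longrightarrow> \<exists>k0. \<forall>k\<ge>k0. \<forall>n\<in>{T k..T (Suc k)}.
         \<bar>\<Sum>i<n. \<phi> j ((f ^^ i) z) - (LINT x|\<alpha> k. \<phi> j x)\<bar> \<le> e * real n"
      by (rule specification_tower[where \<phi> = \<phi> and \<alpha> = \<alpha> and L = "1 + m + n" and w = z0,
            OF comp cont spec])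
        (rule \<phi> drift \<delta>(1) | (use \<alpha>(1) K(1) in blast) | blast)+
    have "limit_measures f z = K"
      using K(1) z(1,4) C(1) c(1,3)
      by (intro limit_measures_eqI[OF comp \<phi>(1) dense, where \<Phi> = \<Phi> and c = c and T = T])
        (auto simp: \<Phi>_def c_eq invariant_probs_def compact_imp_closed)
    moreover have "z \<in> U"
      using u(2) z0(1) z(3)[of 0] \<delta>(3) dist_triangle[of u z z0] by force
    ultimately have "z \<in> transitive_saturated_set f K U"
      using z(2) by (simp add: transitive_saturated_set_def saturated_set_def)
    moreover have "dist ((f ^^ i) x) ((f ^^ (1 + m + i)) z) < \<epsilon>" if "i < n" for i
      using z0(2)[of i] z(3)[of "1 + m + i"] that \<delta>(2)
        dist_triangle[of "(f ^^ i) x" "(f ^^ (1 + m + i)) z" "(f ^^ (1 + m + i)) z0"] by linarith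
    ultimately show "\<exists>z\<in>transitive_saturated_set f K U.
        \<forall>i<n. dist ((f ^^ i) x) ((f ^^ (1 + m + i)) z) < \<epsilon>" by blast
  qed
qed

section \<open>Separated sets and metric mean dimension\<close>

lemma sep_number_mono:
  assumes "TDS f" "\<epsilon> > 0" "Z \<subseteq> Z'"
  shows "sep_number f n \<epsilon> Z \<le> sep_number f n \<epsilon> Z'"
proof -
  obtain E where "E \<in> separated_sets f n \<epsilon> Z" "card E = sep_number f n \<epsilon> Z"
    using sep_number_attained(1)[OF assms(1,2)] by blast
  moreover from this assms(3) have "E \<in> separated_sets f n \<epsilon> Z'"
    by (auto simp: separated_sets_def)
  ultimately show ?thesis using sep_number_attained(2)[OF assms(1,2)] by metis
qed

lemma sep_number_pos:
  assumes "TDS f" "\<epsilon> > 0" "Z \<noteq> {}"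
  shows "sep_number f n \<epsilon> Z > 0"
proof -
  obtain x where "x \<in> Z" using assms(3) by blast
  then have "{x} \<in> separated_sets f n \<epsilon> Z" by (simp add: separated_sets_def)
  then show ?thesis using sep_number_attained(2)[OF assms(1,2)] by fastforce
qed

lemma log_nat_mono: "s \<le> s' \<Longrightarrow> log_nat s \<le> log_nat s'"
  by (auto simp: log_nat_def)

lemma h_UC_mono:
  assumes "TDS f" "\<epsilon> > 0" "Z \<subseteq> Z'"
  shows "h_UC f Z \<epsilon> \<le> h_UC f Z' \<epsilon>"
  unfolding h_UC_def
  by (intro Limsup_mono always_eventually allI ereal_mult_left_mono log_nat_mono
      sep_number_mono assms) auto

lemma h_UC_nonneg:
  assumes "TDS f" "\<epsilon> > 0" "Z \<noteq> {}"
  shows "h_UC f Z \<epsilon> \<ge> 0"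
proof -
  have "0 \<le> ereal (1 / real n) * log_nat (sep_number f n \<epsilon> Z)" for n
    using sep_number_pos[OF assms, of n] by (simp add: log_nat_def)
  then have "limsup (\<lambda>_::nat. 0 :: ereal) \<le> h_UC f Z \<epsilon>"
    unfolding h_UC_def by (intro Limsup_mono always_eventually allI)
  then show ?thesis by (simp add: Limsup_const)
qed

lemma mdim_UC_mono:
  assumes "TDS f" "Z \<subseteq> Z'"
  shows "mdim_UC f Z \<le> mdim_UC f Z'"
  unfolding mdim_UC_def
proof (rule Limsup_mono)
  show "\<forall>\<^sub>F \<epsilon> in at_right 0. h_UC f Z \<epsilon> / ereal \<bar>ln \<epsilon>\<bar> \<le> h_UC f Z' \<epsilon> / ereal \<bar>ln \<epsilon>\<bar>"
  proof (rule eventually_at_rightI)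
    fix \<epsilon> :: real assume "\<epsilon> \<in> {0<..<1}"
    then show "h_UC f Z \<epsilon> / ereal \<bar>ln \<epsilon>\<bar> \<le> h_UC f Z' \<epsilon> / ereal \<bar>ln \<epsilon>\<bar>"
      by (intro ereal_divide_right_mono h_UC_mono assms) auto
  qed simp
qed

text \<open>Two shadowing errors below \<open>\<epsilon>\<close> leave more than
  \<open>\<epsilon>\<close> of a distance above \<open>3 * \<epsilon>\<close>, and this is seen
  before time \<open>n + N\<close>. So the shadows of separated points are distinct and
  separated.\<close>

lemma sep_number_shadowing:
  fixes f :: "'a::metric_space \<Rightarrow> 'a"
  assumes f: "TDS f" and \<epsilon>: "\<epsilon> > 0" and n: "n > 0"
    and shadow: "\<And>x. \<exists>z\<in>Z. \<forall>i<n. dist ((f ^^ i) x) ((f ^^ (N + i)) z) < \<epsilon>"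
  shows "sep_number f n (3 * \<epsilon>) UNIV \<le> sep_number f (n + N) \<epsilon> Z"
proof -
  obtain z where z: "\<And>x. z x \<in> Z" "\<And>x i. i < n \<Longrightarrow> dist ((f ^^ i) x) ((f ^^ (N + i)) (z x)) < \<epsilon>"
    using shadow by metis
  obtain E where E: "E \<in> separated_sets f n (3 * \<epsilon>) UNIV" "finite E" "card E = sep_number f n (3 * \<epsilon>) UNIV"
    using sep_number_attained(1)[OF f, of "3 * \<epsilon>"] \<epsilon> by auto
  have sep: "bowen_dist f (n + N) (z x) (z y) > \<epsilon>" if "x \<in> E" "y \<in> E" "x \<noteq> y" for x y
  proof -
    have "bowen_dist f n x y > 3 * \<epsilon>" using E(1) that by (simp add: separated_sets_def)
    then obtain i where i: "i \<le> n - 1" "dist ((f ^^ i) x) ((f ^^ i) y) > 3 * \<epsilon>"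
      unfolding bowen_dist_def by (subst (asm) Max_gr_iff) auto
    have "dist ((f ^^ i) x) ((f ^^ i) y) \<le> dist ((f ^^ i) x) ((f ^^ (N + i)) (z x))
        + dist ((f ^^ (N + i)) (z x)) ((f ^^ (N + i)) (z y)) + dist ((f ^^ i) y) ((f ^^ (N + i)) (z y))"
      using dist_triangle[of "(f ^^ i) x" "(f ^^ i) y" "(f ^^ (N + i)) (z x)"]
        dist_triangle2[of "(f ^^ (N + i)) (z x)" "(f ^^ i) y" "(f ^^ (N + i)) (z y)"] by linarith
    then have "\<epsilon> < dist ((f ^^ (N + i)) (z x)) ((f ^^ (N + i)) (z y))"
      using z(2)[of i x] z(2)[of i y] i n by linarith
    also have "\<dots> \<le> bowen_dist f (n + N) (z x) (z y)"
      unfolding bowen_dist_def using i(1) n by (intro Max_ge) auto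
    finally show ?thesis .
  qed
  have "inj_on z E"
  proof (rule inj_onI, rule ccontr)
    fix x y assume xy: "x \<in> E" "y \<in> E" "z x = z y" "x \<noteq> y"
    have "bowen_dist f (n + N) (z y) (z y) \<le> 0" by (simp add: bowen_dist_def)
    then show False using sep[OF xy(1,2,4)] xy(3) \<epsilon> by simp
  qed
  moreover have "z ` E \<in> separated_sets f (n + N) \<epsilon> Z"
    using sep z(1) unfolding separated_sets_def by blast
  ultimately show ?thesis
    using sep_number_attained(2)[OF f \<epsilon>] E(3) by (metis card_image)
qed

text \<open>The delay is harmless since \<open>(n + N) / n\<close> tends to 1.\<close>

lemma h_UC_shadowing:
  fixes f :: "'a::metric_space \<Rightarrow> 'a"
  assumes f: "TDS f" and \<epsilon>: "\<epsilon> > 0"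
    and shadow: "\<And>x n. \<exists>z\<in>Z. \<forall>i<n. dist ((f ^^ i) x) ((f ^^ (N + i)) z) < \<epsilon>"
  shows "h_UC f UNIV (3 * \<epsilon>) \<le> h_UC f Z \<epsilon>"
proof -
  let ?b = "\<lambda>n. ereal (1 / real n) * log_nat (sep_number f n \<epsilon> Z)"
  have "Z \<noteq> {}" using shadow by blast
  have "h_UC f UNIV (3 * \<epsilon>) \<le> limsup (\<lambda>n. ereal (real (n + N) / real n) * ?b (n + N))"
    unfolding h_UC_def
  proof (rule Limsup_mono)
    show "\<forall>\<^sub>F n in sequentially. ereal (1 / real n) * log_nat (sep_number f n (3 * \<epsilon>) UNIV)
        \<le> ereal (real (n + N) / real n) * ?b (n + N)"
      using eventually_gt_at_top[of 0]
    proof eventually_elim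
      case (elim n)
      have "log_nat (sep_number f n (3 * \<epsilon>) UNIV) \<le> log_nat (sep_number f (n + N) \<epsilon> Z)"
        using elim by (intro log_nat_mono sep_number_shadowing f \<epsilon> shadow)
      then have "ereal (1 / real n) * log_nat (sep_number f n (3 * \<epsilon>) UNIV)
          \<le> ereal (1 / real n) * log_nat (sep_number f (n + N) \<epsilon> Z)"
        by (intro ereal_mult_left_mono) auto
      also have "\<dots> = ereal (real (n + N) / real n) * ?b (n + N)"
        using elim by (simp add: mult.assoc[symmetric])
      finally show ?case .
    qed
  qed
  also have "\<dots> = 1 * limsup (\<lambda>n. ?b (n + N))"
  proof (rule ereal_limsup_lim_mult)
    have "(\<lambda>n. 1 + real N / real n) \<longlonglongrightarrow> 1 + 0"
      by (intro tendsto_add tendsto_const lim_const_over_n)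
    moreover have "\<forall>\<^sub>F n in sequentially. 1 + real N / real n = real (n + N) / real n"
      using eventually_gt_at_top[of 0] by eventually_elim (simp add: field_simps)
    ultimately have "(\<lambda>n. real (n + N) / real n) \<longlonglongrightarrow> 1"
      by (simp add: tendsto_cong)
    then show "(\<lambda>n. ereal (real (n + N) / real n)) \<longlonglongrightarrow> 1" by (simp add: one_ereal_def)
  qed auto
  also have "\<dots> = h_UC f Z \<epsilon>"
    unfolding h_UC_def using limsup_shift_k[of ?b N] by simp
  finally show ?thesis .
qed

text \<open>Used with \<open>p = \<bar>ln (3 * \<epsilon>)\<bar>\<close> and
  \<open>q = \<bar>ln \<epsilon>\<bar>\<close>: the change of normalization costs a factor
  \<open>c\<close>, also for infinite \<open>b\<close>.\<close>

lemma ereal_divide_le_scaled: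
  fixes a b :: ereal
  assumes "a \<le> b" "b \<ge> 0" "p > 0" "q > 0" "q \<le> c * p"
  shows "a / ereal p \<le> ereal c * (b / ereal q)"
proof -
  have c: "c > 0" using assms(3,4,5) by (metis less_le_trans zero_less_mult_pos2)
  have "a / ereal p \<le> b / ereal p" using assms(1,3) by (intro ereal_divide_right_mono) auto
  also have "\<dots> \<le> ereal c * (b / ereal q)"
  proof (cases b)
    case (real r)
    have "r * q \<le> r * (c * p)" using assms(2,5) real by (intro mult_left_mono) auto
    then show ?thesis using real assms(3,4) by (simp add: field_simps)
  qed (use assms c in auto)
  finally show ?thesis .
qed

lemma ereal_le_if_le_scaled:
  fixes x y :: ereal
  assumes "\<And>c. c > 1 \<Longrightarrow> x \<le> ereal c * y"
  shows "x \<le> y"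
proof (cases y)
  case (real r)
  show ?thesis
  proof (rule ereal_le_epsilon2)
    fix e :: real assume "e > 0"
    \<comment> \<open>The denominator \<open>\<bar>r\<bar> + 1\<close> keeps the excess
      \<open>(c - 1) * r\<close> below \<open>e\<close> and is never 0.\<close>
    define c where "c = 1 + e / (\<bar>r\<bar> + 1)"
    have "c > 1" using \<open>e > 0\<close> by (simp add: c_def add_nonneg_pos)
    then have "x \<le> ereal (c * r)" using assms[of c] real by simp
    also have "c * r = r + e * (r / (\<bar>r\<bar> + 1))" by (simp add: c_def algebra_simps)
    also have "\<dots> \<le> r + e * 1"
      using \<open>e > 0\<close> by (intro add_left_mono mult_left_mono) (auto simp: divide_le_eq)
    finally show "x \<le> y + ereal e" using real by simp
  qed
qed (use assms[of 2] in auto)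

text \<open>The scales \<open>3 * \<epsilon>\<close> and \<open>\<epsilon>\<close> have logarithms
  with ratio tending to 1, so the two dimensions are compared up to any factor
  \<open>c > 1\<close>.\<close>

lemma mdim_UC_shadowing:
  fixes f :: "'a::metric_space \<Rightarrow> 'a"
  assumes f: "TDS f"
    and shadow: "\<And>\<epsilon>. \<epsilon> > 0 \<Longrightarrow> \<exists>N. \<forall>x n. \<exists>z\<in>Z. \<forall>i<n. dist ((f ^^ i) x) ((f ^^ (N + i)) z) < \<epsilon>"
  shows "mdim f \<le> mdim_UC f Z"
proof (rule ereal_le_if_le_scaled)
  fix c :: real assume c: "c > 1"
  have "Z \<noteq> {}" using shadow[of 1] by auto
  have h: "h_UC f UNIV (3 * \<epsilon>) \<le> h_UC f Z \<epsilon>" if pos: "\<epsilon> > 0" for \<epsilon>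
  proof -
    obtain N where "\<And>x n. \<exists>z\<in>Z. \<forall>i<n. dist ((f ^^ i) x) ((f ^^ (N + i)) z) < \<epsilon>"
      using shadow[OF pos] by blast
    then show ?thesis by (rule h_UC_shadowing[OF f pos])
  qed
  \<comment> \<open>Multiplication by 3 preserves the filter \<open>at_right 0\<close>, so
    \<open>\<epsilon>\<close> may be replaced by \<open>3 * \<epsilon>\<close>.\<close>
  have "mdim f = Limsup (filtermap ((*) 3) (at_right 0)) (\<lambda>\<epsilon>. h_UC f UNIV \<epsilon> / ereal \<bar>ln \<epsilon>\<bar>)"
    unfolding mdim_UC_def using filtermap_times_pos_at_right[of 3 "0::real"] by simp
  also have "\<dots> = Limsup (at_right 0) (\<lambda>\<epsilon>. h_UC f UNIV (3 * \<epsilon>) / ereal \<bar>ln (3 * \<epsilon>)\<bar>)"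
    by (intro Limsup_filtermap_eq) (auto simp: inj_def)
  also have "\<dots> \<le> Limsup (at_right 0) (\<lambda>\<epsilon>. ereal c * (h_UC f Z \<epsilon> / ereal \<bar>ln \<epsilon>\<bar>))"
  proof (rule Limsup_mono)
    \<comment> \<open>The threshold is the rearrangement of
      \<open>- ln \<epsilon> < c * (- ln \<epsilon> - ln 3)\<close>. It also implies
      \<open>3 * \<epsilon> < 1\<close>, which fixes the signs of the logarithms.\<close>
    have "\<forall>\<^sub>F \<epsilon> in at_right 0. ln (\<epsilon>::real) < - (c * ln 3 / (c - 1))"
      using ln_at_0 by (simp add: filterlim_at_bot_dense)
    then show "\<forall>\<^sub>F \<epsilon> in at_right 0. h_UC f UNIV (3 * \<epsilon>) / ereal \<bar>ln (3 * \<epsilon>)\<bar>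
        \<le> ereal c * (h_UC f Z \<epsilon> / ereal \<bar>ln \<epsilon>\<bar>)"
      using eventually_at_right_less[of "0::real"]
    proof eventually_elim
      case (elim \<epsilon>)
      have "0 < ln (3::real)" by simp
      have less: "c * ln 3 < (c - 1) * (- ln \<epsilon>)"
        using elim(1) c by (simp add: field_simps)
      have "(c - 1) * ln 3 < c * ln 3" using \<open>0 < ln 3\<close> by simp
      with less have "(c - 1) * ln 3 < (c - 1) * (- ln \<epsilon>)" by linarith
      then have L: "ln 3 < - ln \<epsilon>" by (rule mult_left_less_imp_less) (use c in simp)
      have "ln (3 * \<epsilon>) = ln 3 + ln \<epsilon>" using elim(2) by (simp add: ln_mult)
      then have abs: "\<bar>ln (3 * \<epsilon>)\<bar> = - ln \<epsilon> - ln 3" "\<bar>ln \<epsilon>\<bar> = - ln \<epsilon>"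
        using L \<open>0 < ln 3\<close> by linarith+
      show ?case unfolding abs
      proof (rule ereal_divide_le_scaled[OF h[OF elim(2)] h_UC_nonneg[OF f elim(2) \<open>Z \<noteq> {}\<close>]])
        show "0 < - ln \<epsilon> - ln 3" "0 < - ln \<epsilon>" using L \<open>0 < ln 3\<close> by linarith+
        show "- ln \<epsilon> \<le> c * (- ln \<epsilon> - ln 3)" using less by (simp add: algebra_simps)
      qed
    qed
  qed
  also have "\<dots> = ereal c * mdim_UC f Z"
    unfolding mdim_UC_def using c by (intro Limsup_ereal_mult_left) auto
  finally show "mdim f \<le> ereal c * mdim_UC f Z" .
qed

theorem theorem1p4:
  fixes f :: "'a::metric_space \<Rightarrow> 'a"
    and K :: "'a measure set"
    and U :: "'a set"
  assumes "TDS f"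
    and "specification_property f"
    and "K \<subseteq> invariant_probs f"
    and "K \<noteq> {}"
    and "compactin weak_star K"
    and "connectedin weak_star K"
    and "open U"
    and "U \<noteq> {}"
  shows "mdim_UC f (saturated_set f K) = mdim_UC f (transitive_saturated_set f K U)
       \<and> mdim_UC f (transitive_saturated_set f K U) = mdim f"
proof -
  have "mdim f \<le> mdim_UC f (transitive_saturated_set f K U)"
    by (rule mdim_UC_shadowing[OF assms(1)])
      (use transitive_saturated_shadowing[OF assms] in metis)
  moreover have "mdim_UC f (transitive_saturated_set f K U) \<le> mdim_UC f (saturated_set f K)"
    by (rule mdim_UC_mono[OF assms(1)]) (auto simp: transitive_saturated_set_def)
  moreover have "mdim_UC f (saturated_set f K) \<le> mdim f"
    by (rule mdim_UC_mono[OF assms(1)]) simp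
  ultimately show ?thesis by (auto intro: antisym)
qed

end
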